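(* Let $X$ be a reflexive Banach space, $S\subset X$, and let $*:S\to S$ be a symmetrization satisfying the requirements (1)--(5) of the abstract symmetrization framework (see context) with polarizations parametrized by $\mathcal H_*$ and with a Banach space $V$. Let $V$ and $W$ be Banach spaces containing $X$ such that (a) the injections $X\hookrightarrow V\hookrightarrow W$ are continuous. Let $f:X\to\mathbb{R}\cup\{+\infty\}$ be a lower semi-continuous function such that $$\forall (u,\xi)\in\mathrm{epi}(f):\quad f(u)<\xi\ \Longrightarrow\ |d\mathcal G_f|(u,\xi)=1 .$$ Let $\mathbb D$ and $\mathbb S$ denote the closed unit ball and the unit sphere of $\mathbb{R}^m$ ($m\ge1$), let $\Gamma_0\subset C(\mathbb S,X)$ and $\Gamma=\{\gamma\in C(\mathbb D,X):\gamma|_{\mathbb S}\in\Gamma_0\}$. Assume that $$+\infty>c=\inf_{\gamma\in\Gamma}\sup_{\tau\in\mathbb D}f(\gamma(\tau))>\sup_{\gamma_0\in\Gamma_0}\sup_{\tau\in\mathbb S}f(\gamma_0(\tau))=a,$$ and that the following conditions hold: (b) for all $H\in\mathcal H_*$ and all $u\in S$: $f(u^H)\le f(u)$; (c) for all $\gamma\in\Gamma$ there exist $\hat\gamma\in\Gamma$ and $H_0\in\mathcal H_*$ such that $\hat\gamma(\mathbb D)\subset S$, $f\circ\hat\gamma\le f\circ\gamma$ and $\hat\gamma|_{\mathbb S}^{H_0}\in\Gamma_0$; (d) each Palais--Smale sequence $(u_h)\subset X$ for $f$ is bounded in $X$; (e) for each Palais--Smale sequence $(u_h)\subset X$ for $f$,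 the sequence $(u_h^* )$ converges in $W$. Then there exist $u\in X$ and a Palais--Smale sequence $(u_h)\subset X$ for $f$ at level $c$ such that 1. $u_h\to u$ weakly in $X$ as $h\to\infty$; 2. $u_h\to u$ strongly in $W$ as $h\to\infty$; 3. if requirements (4)--(5) of the abstract symmetrization framework hold with $W$ in place of $V$, then $u=u^*$ in $W$.
   Context: Abstract symmetrization framework. $X$ and $V$ are Banach spaces, $S\subset X$; there are two maps $*:S\to S$, $u\mapsto u^*$ (symmetrization) and $h:S\times\mathcal H_*\to S$, $(u,H)\mapsto u^H$ (polarization), where $\mathcal H_*$ is a path-connected topological space, such that: (1) $X$ is continuously embedded in $V$; (2) $h$ is continuous; (3) for each $u\in S$ and $H\in\mathcal H_*$: $(u^* )^H=(u^H)^*=u^*$ and $u^{HH}=u^H$; (4) there exists a sequence $(H_m)$ in $\mathcal H_*$ such that, for $u\in S$, $u^{H_1\cdots H_m}$ converges to $u^*$ in $V$ as $m\to\infty$; (5) for all $u,v\in S$ and $H\in\mathcal H_*$: $\|u^H-v^H\|_V\le\|u-v\|_V$. Furthermore $*$ is extended to the whole of $X$ by $u^*:=(\Theta(u))^*$ for $u\in X$, where $\Theta:(X,\|\cdot\|_V)\to(S,\|\cdot\|_V)$ is a Lipschitz function with $\Theta|_S=\mathrm{Id}|_S$. For $\gamma$ with values in $S$, $\gamma|_{\mathbb S}^{H_0}$ denotes $\tau\mapsto(\gamma(\tau))^{H_0}$, $\tau\in\mathbb S$. Weak slope. For a metric space $(Y,d)$ and $f:Y\to[-\infty,+\infty]$,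 let $\mathrm{epi}(f)=\{(u,\xi)\in Y\times\mathbb{R}:f(u)\le\xi\}$, with metric $d((u,\xi),(v,\mu))=(d(u,v)^2+(\xi-\mu)^2)^{1/2}$. For $u$ with $f(u)\in\mathbb{R}$, the weak slope $|df|(u)\in[0,+\infty]$ is the supremum of the $\sigma\in[0,\infty)$ such that there exist $\delta>0$ and a continuous map $\mathcal H:(B((u,f(u)),\delta)\cap\mathrm{epi}(f))\times[0,\delta]\to Y$ with $d(\mathcal H((\xi,\mu),t),\xi)\le t$ and $f(\mathcal H((\xi,\mu),t))\le f(\xi)-\sigma t$ for all $(\xi,\mu)\in B((u,f(u)),\delta)\cap\mathrm{epi}(f)$, $t\in[0,\delta]$ ($B$ denotes open balls). The function $\mathcal G_f:\mathrm{epi}(f)\to\mathbb{R}$ is $\mathcal G_f(u,\xi)=\xi$, and $|d\mathcal G_f|$ is its weak slope on the metric space $\mathrm{epi}(f)$. A Palais--Smale sequence for $f$ at level $c\in\mathbb{R}$ is a sequence $(u_h)\subset X$ with $f(u_h)\in\mathbb{R}$, $f(u_h)\to c$ and $|df|(u_h)\to0$ as $h\to\infty$; a Palais--Smale sequence for $f$ is one at some level in $\mathbb{R}$.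
   Formalization: In item 3 it is additionally assumed that Θ, the map used to extend * to X, is Lipschitz for the W-norm (the framework with W in place of V); with only (4)–(5) for W, item 3 can fail. *)

theory Defs
  imports "HOL-Analysis.Analysis"
begin

definition reflexive_banach :: "'a::banach itself \<Rightarrow> bool" where
  "reflexive_banach _ \<longleftrightarrow>
     (\<forall>\<phi> :: ('a \<Rightarrow>\<^sub>L real) \<Rightarrow>\<^sub>L real. \<exists>x. \<forall>l. blinfun_apply \<phi> l = blinfun_apply l x)"

definition weakly_converges :: "(nat \<Rightarrow> 'a::real_normed_vector) \<Rightarrow> 'a \<Rightarrow> bool" where
  "weakly_converges us u \<longleftrightarrow>
     (\<forall>l :: 'a \<Rightarrow>\<^sub>L real. (\<lambda>n. blinfun_apply l (us n)) \<longlonglongrightarrow> blinfun_apply l u)"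

text \<open>An inclusion of Banach spaces \<open>X \<subseteq> V\<close> is represented by an injective map between types.\<close>

definition continuous_embedding :: "('a::real_normed_vector \<Rightarrow> 'b::real_normed_vector) \<Rightarrow> bool" where
  "continuous_embedding i \<longleftrightarrow> bounded_linear i \<and> inj i"

definition lower_semicontinuous :: "('a::topological_space \<Rightarrow> ereal) \<Rightarrow> bool" where
  "lower_semicontinuous f \<longleftrightarrow> (\<forall>x. \<forall>y<f x. eventually (\<lambda>z. y < f z) (nhds x))"

section \<open>Weak slope\<close>

text \<open>The metric space \<open>Y\<close> is a subset of a metric type, so that the weak slope can also be taken
  on an epigraph. The product metric of the library is the Euclidean combination
  \<open>sqrt (d(u,v)\<^sup>2 + (\<xi> - \<mu>)\<^sup>2)\<close>.\<close>

definition epi :: "'a set \<Rightarrow> ('a \<Rightarrow> ereal) \<Rightarrow> ('a \<times> real) set" where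
  "epi Y f = {(u, \<xi>). u \<in> Y \<and> f u \<le> ereal \<xi>}"

text \<open>Meaningful only for \<open>u \<in> Y\<close> with \<open>f u\<close> finite.\<close>

definition weak_slope :: "'a::metric_space set \<Rightarrow> ('a \<Rightarrow> ereal) \<Rightarrow> 'a \<Rightarrow> ereal" where
  "weak_slope Y f u = Sup {ereal \<sigma> | \<sigma>. 0 \<le> \<sigma> \<and>
     (\<exists>\<delta>>0. \<exists>\<H> :: ('a \<times> real) \<times> real \<Rightarrow> 'a.
        continuous_on ((ball (u, real_of_ereal (f u)) \<delta> \<inter> epi Y f) \<times> {0..\<delta>}) \<H> \<and>
        (\<forall>(\<xi>, \<mu>) \<in> ball (u, real_of_ereal (f u)) \<delta> \<inter> epi Y f. \<forall>t\<in>{0..\<delta>}.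
           \<H> ((\<xi>, \<mu>), t) \<in> Y \<and>
           dist (\<H> ((\<xi>, \<mu>), t)) \<xi> \<le> t \<and>
           f (\<H> ((\<xi>, \<mu>), t)) \<le> f \<xi> - ereal (\<sigma> * t)))}"

definition epi_height :: "'a \<times> real \<Rightarrow> ereal" where
  "epi_height p = ereal (snd p)"

definition palais_smale_at :: "('a::metric_space \<Rightarrow> ereal) \<Rightarrow> ereal \<Rightarrow> (nat \<Rightarrow> 'a) \<Rightarrow> bool" where
  "palais_smale_at f c us \<longleftrightarrow>
     \<bar>c\<bar> \<noteq> \<infinity> \<and> (\<forall>n. \<bar>f (us n)\<bar> \<noteq> \<infinity>) \<and> (\<lambda>n. f (us n)) \<longlonglongrightarrow> c \<and>
     (\<lambda>n. weak_slope UNIV f (us n)) \<longlonglongrightarrow> 0"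

definition palais_smale :: "('a::metric_space \<Rightarrow> ereal) \<Rightarrow> (nat \<Rightarrow> 'a) \<Rightarrow> bool" where
  "palais_smale f us \<longleftrightarrow> (\<exists>c. palais_smale_at f c us)"

section \<open>Abstract symmetrization\<close>

text \<open>\<open>iter_pol pol Hs m u\<close> is \<open>u\<close> polarized successively by \<open>Hs 0, \<dots>, Hs (m - 1)\<close>, in this order.\<close>

primrec iter_pol :: "('x \<Rightarrow> 'h \<Rightarrow> 'x) \<Rightarrow> (nat \<Rightarrow> 'h) \<Rightarrow> nat \<Rightarrow> 'x \<Rightarrow> 'x" where
  "iter_pol pol Hs 0 u = u"
| "iter_pol pol Hs (Suc m) u = pol (iter_pol pol Hs m u) (Hs m)"

text \<open>The three requirements that involve the norm of the ambient space, for the ambient space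
  given by the embedding \<open>i\<close>.\<close>

definition polarizations_approximate ::
  "'x set \<Rightarrow> ('x \<Rightarrow> 'x) \<Rightarrow> ('x \<Rightarrow> 'h \<Rightarrow> 'x) \<Rightarrow> ('x \<Rightarrow> 'b::real_normed_vector) \<Rightarrow> bool" where
  "polarizations_approximate S star pol i \<longleftrightarrow>
     (\<exists>Hs. \<forall>u\<in>S. (\<lambda>m. i (iter_pol pol Hs m u)) \<longlonglongrightarrow> i (star u))"

definition polarizations_contract ::
  "'x set \<Rightarrow> ('x \<Rightarrow> 'h \<Rightarrow> 'x) \<Rightarrow> ('x \<Rightarrow> 'b::real_normed_vector) \<Rightarrow> bool" where
  "polarizations_contract S pol i \<longleftrightarrow>
     (\<forall>u\<in>S. \<forall>v\<in>S. \<forall>H. norm (i (pol u H) - i (pol v H)) \<le> norm (i u - i v))"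

definition lipschitz_wrt :: "('x \<Rightarrow> 'b::real_normed_vector) \<Rightarrow> ('x \<Rightarrow> 'x) \<Rightarrow> bool" where
  "lipschitz_wrt i \<Theta> \<longleftrightarrow> (\<exists>L. \<forall>u v. norm (i (\<Theta> u) - i (\<Theta> v)) \<le> L * norm (i u - i v))"

text \<open>The space of polarizers is the type \<open>'h\<close>. The values of \<open>star\<close> and \<open>pol\<close> outside \<open>S\<close> are
  irrelevant.\<close>

definition symmetrization_framework ::
  "'x::banach set \<Rightarrow> ('x \<Rightarrow> 'x) \<Rightarrow> ('x \<Rightarrow> 'h::topological_space \<Rightarrow> 'x) \<Rightarrow> ('x \<Rightarrow> 'x) \<Rightarrow>
    ('x \<Rightarrow> 'v::banach) \<Rightarrow> bool" where
  "symmetrization_framework S star pol \<Theta> i \<longleftrightarrow>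
     star \<in> S \<rightarrow> S \<and> (\<forall>u\<in>S. \<forall>H. pol u H \<in> S) \<and>
     path_connected (UNIV :: 'h set) \<and>
     continuous_embedding i \<and>
     continuous_on (S \<times> UNIV) (\<lambda>(u, H). pol u H) \<and>
     (\<forall>u\<in>S. \<forall>H. pol (star u) H = star u \<and> star (pol u H) = star u \<and>
        pol (pol u H) H = pol u H) \<and>
     polarizations_approximate S star pol i \<and>
     polarizations_contract S pol i \<and>
     \<Theta> \<in> UNIV \<rightarrow> S \<and> (\<forall>u\<in>S. \<Theta> u = u) \<and> lipschitz_wrt i \<Theta>"

definition extended_sym :: "('x \<Rightarrow> 'x) \<Rightarrow> ('x \<Rightarrow> 'x) \<Rightarrow> 'x \<Rightarrow> 'x" where
  "extended_sym star \<Theta> u = star (\<Theta> u)"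

text \<open>Elements of \<open>C(D, X)\<close> are represented by extensional functions, so that equality in this
  space is equality on \<open>D\<close>, and restriction is the library's \<open>restrict\<close>.\<close>

definition cmaps :: "'a::topological_space set \<Rightarrow> ('a \<Rightarrow> 'b::topological_space) set" where
  "cmaps D = {g \<in> extensional D. continuous_on D g}"

end

theory Submission
  imports Defs
begin

text \<open>
  The functional \<open>f\<close> is only lower semicontinuous, so minimax is carried out on its epigraph, where
  the height \<open>snd\<close> is continuous and, by the hypothesis on \<open>\<G>\<^sub>f\<close>, points strictly above the graph
  are never almost critical. A path of \<open>\<Gamma>\<close> is lifted to the epigraph after inserting two collars at the
  boundary of the disc: on the outer one the polarizations are run through along paths in the space
  of polarizers, on the inner one only the height changes. Above the boundary level \<open>a\<close> the lifted
  path is then close to its symmetrization. Ekeland's principle in the space of such lifts with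
  fixed boundary values yields a nearby path; since paths are compact, finitely many local
  descents can be patched along it, so it must pass through an almost critical point.

  No Eberlein theorem is needed for the weak convergence. If \<open>u\<^sub>h\<close> is bounded in the reflexive space
  \<open>X\<close> and converges to \<open>w\<close> in \<open>W\<close>, any linear functional on the dual dominated by
  \<open>l \<mapsto> limsup l u\<^sub>h\<close> is the evaluation at a point of \<open>X\<close>, and this point can only be \<open>w\<close>. Choosing
  the functional to attain the upper limit at a prescribed \<open>l\<close> shows that \<open>l u\<^sub>h\<close> converges.
\<close>

section \<open>The Hahn--Banach theorem and weak limits\<close>

text \<open>Homogeneity is only an inequality for positive factors, the form checked most directly
  for infima and upper limits; the inverse factor gives equality.\<close>

definition sublinear :: "('a::real_vector \<Rightarrow> real) \<Rightarrow> bool" where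
  "sublinear p \<longleftrightarrow> p 0 = 0 \<and> (\<forall>x y. p (x + y) \<le> p x + p y) \<and>
     (\<forall>t>0. \<forall>x. p (t *\<^sub>R x) \<le> t * p x)"

lemma sublinearI:
  assumes "p 0 = 0" "\<And>x y. p (x + y) \<le> p x + p y" "\<And>t x. t > 0 \<Longrightarrow> p (t *\<^sub>R x) \<le> t * p x"
  shows "sublinear p"
  using assms by (auto simp: sublinear_def)

lemma sublinear_scaleR:
  assumes "sublinear p" "t \<ge> 0" shows "p (t *\<^sub>R x) = t * p x"
proof (cases "t = 0")
  case False
  with assms have t: "t > 0" by simp
  have "p ((1/t) *\<^sub>R (t *\<^sub>R x)) \<le> (1/t) * p (t *\<^sub>R x)"
    using assms(1) t unfolding sublinear_def by (meson zero_less_divide_1_iff)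
  then have "t * p x \<le> p (t *\<^sub>R x)" using t by (simp add: field_simps)
  then show ?thesis using assms(1) t by (auto simp: sublinear_def intro: antisym)
qed (use assms in \<open>auto simp: sublinear_def\<close>)

lemma sublinear_minus_ge:
  assumes "sublinear p" shows "- p (- x) \<le> p x"
proof -
  have "p (x + - x) \<le> p x + p (- x)" "p 0 = 0" using assms unfolding sublinear_def by blast+
  then show ?thesis by simp
qed

text \<open>The witness is \<open>q x = inf {p (x + t v) - t p v | t \<ge> 0}\<close>. It shows that a minimal sublinear functional
  is additive.\<close>

lemma sublinear_slide:
  assumes p: "sublinear p"
  obtains q where "sublinear q" "\<And>x. q x \<le> p x" "\<And>x. q x \<le> p (x + v) - p v"
proof
  define A where "A x t = p (x + t *\<^sub>R v) - t * p v" for x t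
  define q where "q x = (INF t\<in>{0..}. A x t)" for x
  have A_ge: "- p (- x) \<le> A x t" if "t \<ge> 0" for x t
  proof -
    have "p ((x + t *\<^sub>R v) + - x) \<le> p (x + t *\<^sub>R v) + p (- x)"
      using p unfolding sublinear_def by blast
    moreover have "(x + t *\<^sub>R v) + - x = t *\<^sub>R v" by simp
    ultimately show ?thesis using sublinear_scaleR[OF p that, of v] by (simp add: A_def)
  qed
  have q_le: "q x \<le> A x t" if "t \<ge> 0" for x t
    unfolding q_def by (rule cINF_lower) (use that A_ge in \<open>auto intro!: bdd_belowI2\<close>)
  have q_ge: "r \<le> q x" if "\<And>t. t \<ge> 0 \<Longrightarrow> r \<le> A x t" for x r
    unfolding q_def by (rule cINF_greatest) (use that in auto)
  show "sublinear q"
  proof (rule sublinearI)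
    have "A 0 t = 0" if "t \<ge> 0" for t using sublinear_scaleR[OF p that] by (simp add: A_def)
    then show "q 0 = 0" using q_le[of 0 0] q_ge[of 0 0] by force
  next
    fix x y
    have *: "q (x + y) \<le> A x s + A y t" if "s \<ge> 0" "t \<ge> 0" for s t
    proof -
      have "p ((x + s *\<^sub>R v) + (y + t *\<^sub>R v)) \<le> p (x + s *\<^sub>R v) + p (y + t *\<^sub>R v)"
        using p unfolding sublinear_def by blast
      moreover have "(x + s *\<^sub>R v) + (y + t *\<^sub>R v) = (x + y) + (s + t) *\<^sub>R v"
        by (simp add: scaleR_add_left)
      ultimately have "A (x + y) (s + t) \<le> A x s + A y t" by (simp add: A_def algebra_simps)
      with q_le[of "s + t" "x + y"] that show ?thesis by simp
    qed
    have "q (x + y) - A x s \<le> q y" if "s \<ge> 0" for s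
      by (rule q_ge) (use *[OF that] in \<open>simp add: algebra_simps\<close>)
    then have "q (x + y) - q y \<le> q x" by (intro q_ge) (simp add: algebra_simps)
    then show "q (x + y) \<le> q x + q y" by simp
  next
    fix r :: real and x assume r: "r > 0"
    have "q (r *\<^sub>R x) / r \<le> q x"
    proof (rule q_ge)
      fix t :: real assume t: "t \<ge> 0"
      have "r *\<^sub>R x + (r * t) *\<^sub>R v = r *\<^sub>R (x + t *\<^sub>R v)" by (simp add: scaleR_add_right)
      then have "A (r *\<^sub>R x) (r * t) = r * A x t"
        using sublinear_scaleR[OF p, of r "x + t *\<^sub>R v"] r by (simp add: A_def algebra_simps)
      then show "q (r *\<^sub>R x) / r \<le> A x t"
        using q_le[of "r * t" "r *\<^sub>R x"] r t by (simp add: field_simps)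
    qed
    then show "q (r *\<^sub>R x) \<le> r * q x" using r by (simp add: field_simps)
  qed
  show "q x \<le> p x" for x using q_le[of 0 x] by (simp add: A_def)
  show "q x \<le> p (x + v) - p v" for x using q_le[of 1 x] by (simp add: A_def)
qed

text \<open>Zorn's lemma applies because the pointwise infimum of a chain of sublinear functionals
  is sublinear: totality lets two members be replaced by the smaller one.\<close>

lemma minimal_sublinear_below:
  assumes p: "sublinear p"
  obtains q where "sublinear q" "q \<le> p" "\<And>r. sublinear r \<Longrightarrow> r \<le> q \<Longrightarrow> r = q"
proof -
  define A where "A = {q. sublinear q \<and> q \<le> p}"
  \<comment> \<open>The order is reversed, so that Zorn's maximal element is a minimal
    functional.\<close>
  let ?P = "\<lambda>q r :: 'a \<Rightarrow> real. r \<le> q"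
  have "\<exists>m\<in>A. \<forall>a\<in>A. ?P m a \<longrightarrow> a = m"
  proof (rule predicate_Zorn)
    show "partial_order_on A (relation_of ?P A)"
      by (rule partial_order_on_relation_ofI) auto
  next
    fix C assume C: "C \<in> Chains (relation_of ?P A)"
    show "\<exists>u\<in>A. \<forall>a\<in>C. u \<le> a"
    proof (cases "C = {}")
      case True then show ?thesis using p by (auto simp: A_def)
    next
      case False
      have CA: "C \<subseteq> A" using C by (auto simp: Chains_def relation_of_def)
      have total: "q \<le> r \<or> r \<le> q" if "q \<in> C" "r \<in> C" for q r
        using C that by (auto simp: Chains_def relation_of_def)
      define u where "u x = (INF q\<in>C. q x)" for x
      \<comment> \<open>This bound, uniform in \<open>q\<close>, keeps the infimum over the chain
        finite.\<close>
      have ge: "- p (- x) \<le> q x" if "q \<in> C" for q x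
      proof -
        have "sublinear q" "q (- x) \<le> p (- x)" using that CA by (auto simp: A_def le_fun_def)
        then show ?thesis using sublinear_minus_ge[of q x] by linarith
      qed
      have u_le: "u x \<le> q x" if "q \<in> C" for q x
        unfolding u_def by (rule cINF_lower) (use that ge in \<open>auto intro!: bdd_belowI2\<close>)
      have u_ge: "r \<le> u x" if "\<And>q. q \<in> C \<Longrightarrow> r \<le> q x" for x r
        unfolding u_def by (rule cINF_greatest) (use that False in auto)
      have "sublinear u"
      proof (rule sublinearI)
        show "u 0 = 0"
          unfolding u_def using False CA by (subst INF_cong[OF refl, of C _ "\<lambda>_. 0"]) (auto simp: A_def sublinear_def)
      next
        fix x y
        have *: "u (x + y) \<le> q x + r y" if qr: "q \<in> C" "r \<in> C" for q r
        proof -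
          have "\<exists>s\<in>C. s \<le> q \<and> s \<le> r" using total qr by blast
          then obtain s where s: "s \<in> C" "s x \<le> q x" "s y \<le> r y" by (auto simp: le_fun_def)
          have "s (x + y) \<le> s x + s y" using s CA by (auto simp: A_def sublinear_def)
          with s u_le[of s "x + y"] show ?thesis by linarith
        qed
        have "u (x + y) - q x \<le> u y" if "q \<in> C" for q
          by (rule u_ge) (use *[OF that] in \<open>simp add: algebra_simps\<close>)
        then have "u (x + y) - u y \<le> u x" by (intro u_ge) (simp add: algebra_simps)
        then show "u (x + y) \<le> u x + u y" by simp
      next
        fix t :: real and x assume t: "t > 0"
        have "u (t *\<^sub>R x) / t \<le> u x"
        proof (rule u_ge)
          fix q assume q: "q \<in> C"
          then have "q (t *\<^sub>R x) \<le> t * q x" using t CA by (auto simp: A_def sublinear_def)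
          with u_le[OF q, of "t *\<^sub>R x"] show "u (t *\<^sub>R x) / t \<le> q x"
            using t by (simp add: field_simps)
        qed
        then show "u (t *\<^sub>R x) \<le> t * u x" using t by (simp add: field_simps)
      qed
      moreover have "u \<le> p"
      proof -
        obtain q where "q \<in> C" using False by blast
        then have "u \<le> q" "q \<le> p" using u_le CA by (auto simp: A_def le_fun_def)
        then show ?thesis by (rule order_trans)
      qed
      ultimately show ?thesis using u_le by (auto simp: A_def le_fun_def)
    qed
  qed
  then obtain m where "m \<in> A" "\<And>a. a \<in> A \<Longrightarrow> a \<le> m \<Longrightarrow> a = m" by blast
  then show ?thesis by (intro that[of m]) (auto simp: A_def)
qed

text \<open>Sliding along \<open>v\<close> first yields \<open>p' (- v) \<le> - p v\<close>, a bound
  inherited by everything below \<open>p'\<close>. A minimal \<open>q\<close> below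
  \<open>p'\<close> equals each of its own slides, hence is additive, and oddness turns the bound
  into \<open>q v = p v\<close>.\<close>

theorem hahn_banach_dominated:
  fixes p :: "'a::real_vector \<Rightarrow> real"
  assumes p: "sublinear p"
  obtains \<phi> where "linear \<phi>" "\<And>x. \<phi> x \<le> p x" "\<phi> v = p v"
proof -
  obtain p' where p': "sublinear p'" "\<And>x. p' x \<le> p x" "\<And>x. p' x \<le> p (x + v) - p v"
    using sublinear_slide[OF p, of v] by blast
  obtain q where q: "sublinear q" "q \<le> p'" "\<And>r. sublinear r \<Longrightarrow> r \<le> q \<Longrightarrow> r = q"
    using minimal_sublinear_below[OF p'(1)] by blast
  have add: "q (x + y) = q x + q y" for x y
  proof -
    obtain r where r: "sublinear r" "\<And>x. r x \<le> q x" "\<And>x. r x \<le> q (x + y) - q y"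
      using sublinear_slide[OF q(1), of y] by blast
    then have "r = q" using q(3) by (simp add: le_fun_def)
    then have "q x \<le> q (x + y) - q y" using r(3)[of x] by simp
    moreover have "q (x + y) \<le> q x + q y" using q(1) by (auto simp: sublinear_def)
    ultimately show ?thesis by simp
  qed
  have q0: "q 0 = 0" using q(1) by (simp add: sublinear_def)
  have minus: "q (- x) = - q x" for x using add[of x "- x"] q0 by simp
  have "q (t *\<^sub>R x) = t * q x" for t x
  proof (cases "t \<ge> 0")
    case False
    have "q (t *\<^sub>R x) = - q ((- t) *\<^sub>R x)" using minus[of "(- t) *\<^sub>R x"] by simp
    also have "\<dots> = t * q x" using sublinear_scaleR[OF q(1), of "- t" x] False by simp
    finally show ?thesis .
  qed (rule sublinear_scaleR[OF q(1)])
  then have "linear q" using add by (intro linearI) auto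
  moreover have le: "q x \<le> p x" for x by (rule order_trans[OF le_funD[OF q(2)] p'(2)])
  moreover have "q v = p v"
  proof -
    have "q (- v) \<le> p (- v + v) - p v" by (rule order_trans[OF le_funD[OF q(2)] p'(3)])
    then have "- q v \<le> - p v" using minus[of v] p by (simp add: sublinear_def)
    then show ?thesis using le[of v] by simp
  qed
  ultimately show ?thesis using that by blast
qed

corollary norming_functional:
  fixes w :: "'a::real_normed_vector"
  obtains l :: "'a \<Rightarrow>\<^sub>L real" where "blinfun_apply l w = norm w"
proof -
  have "sublinear (norm :: 'a \<Rightarrow> real)" by (rule sublinearI) (auto intro: norm_triangle_ineq)
  then obtain \<phi> where \<phi>: "linear \<phi>" "\<And>x. \<phi> x \<le> norm x" "\<phi> w = norm w"
    using hahn_banach_dominated[of norm w] by blast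
  have "norm (\<phi> x) \<le> norm x" for x
    using \<phi>(2)[of x] \<phi>(2)[of "- x"] linear_neg[OF \<phi>(1), of x] by (simp add: abs_le_iff)
  then have "bounded_linear \<phi>"
    using \<phi>(1) by (intro bounded_linear_intro[where K = 1]) (auto simp: linear_add linear_scale)
  then show ?thesis using \<phi>(3) by (intro that[of "Blinfun \<phi>"]) (simp add: bounded_linear_Blinfun_apply)
qed

section \<open>Weak convergence from convergence in a larger space\<close>

lemma weak_limit_of_strong_limit_in_superspace:
  fixes us :: "nat \<Rightarrow> 'x::banach" and j :: "'x \<Rightarrow> 'w::real_normed_vector"
  assumes refl: "reflexive_banach TYPE('x)" and bdd: "bounded (range us)"
    and j: "bounded_linear j" "inj j" and lim: "(\<lambda>n. j (us n)) \<longlonglongrightarrow> w"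
  obtains u where "j u = w" "weakly_converges us u"
proof -
  \<comment> \<open>\<open>p l = Inf (R l)\<close> is the upper limit of \<open>l (us n)\<close>.\<close>
  define R where "R l = {r. eventually (\<lambda>n. blinfun_apply l (us n) \<le> r) sequentially}"
    for l :: "'x \<Rightarrow>\<^sub>L real"
  define p where "p l = Inf (R l)" for l
  obtain C where C: "C > 0" "\<And>n. norm (us n) \<le> C"
    using bdd by (auto simp: bounded_pos)
  have l_bound: "\<bar>blinfun_apply l (us n)\<bar> \<le> norm l * C" for l :: "'x \<Rightarrow>\<^sub>L real" and n
    using norm_blinfun[of l "us n"] mult_left_mono[OF C(2)[of n], of "norm l"] by simp
  \<comment> \<open>Boundedness makes every \<open>R l\<close> nonempty and bounded below, so its
    infimum is a genuine real number.\<close>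
  have R_bound: "norm l * C \<in> R l" for l
    using l_bound[of l] by (auto simp: R_def abs_le_iff)
  have R_ge: "- (norm l * C) \<le> r" if "r \<in> R l" for r l
  proof -
    have "eventually (\<lambda>n. blinfun_apply l (us n) \<le> r) sequentially" using that by (simp add: R_def)
    then obtain n where "blinfun_apply l (us n) \<le> r" by (auto simp: eventually_sequentially)
    then show ?thesis using l_bound[of l n] by linarith
  qed
  have p_le: "p l \<le> r" if "r \<in> R l" for r l
    unfolding p_def using that R_ge by (intro cInf_lower) (auto intro!: bdd_belowI)
  have p_ge: "b \<le> p l" if "\<And>r. r \<in> R l \<Longrightarrow> b \<le> r" for b l
    unfolding p_def using that R_bound[of l] by (intro cInf_greatest) auto
  have R_iff: "r \<in> R l \<longleftrightarrow> eventually (\<lambda>n. blinfun_apply l (us n) \<le> r) sequentially" for r l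
    by (simp add: R_def)
  have sub: "sublinear p"
  proof (rule sublinearI)
    have "R 0 = {0..}" by (auto simp: R_def)
    then show "p 0 = 0" by (simp add: p_def)
  next
    fix k l
    have *: "p (k + l) \<le> r + s" if "r \<in> R k" "s \<in> R l" for r s
    proof (rule p_le)
      show "r + s \<in> R (k + l)"
        using that unfolding R_iff
        by eventually_elim (auto simp: plus_blinfun.rep_eq)
    qed
    have "p (k + l) - r \<le> p l" if "r \<in> R k" for r
      by (rule p_ge) (use *[OF that] in \<open>simp add: algebra_simps\<close>)
    then have "p (k + l) - p l \<le> p k" by (intro p_ge) (simp add: algebra_simps)
    then show "p (k + l) \<le> p k + p l" by simp
  next
    fix t :: real and l assume t: "t > 0"
    have "p (t *\<^sub>R l) / t \<le> p l"
    proof (rule p_ge)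
      fix r assume "r \<in> R l"
      then have "t * r \<in> R (t *\<^sub>R l)"
        unfolding R_iff by eventually_elim (use t in \<open>auto simp: scaleR_blinfun.rep_eq\<close>)
      from p_le[OF this] show "p (t *\<^sub>R l) / t \<le> r" using t by (simp add: field_simps)
    qed
    then show "p (t *\<^sub>R l) \<le> t * p l" using t by (simp add: field_simps)
  qed
  have p_lim: "p l \<le> L" if "(\<lambda>n. blinfun_apply l (us n)) \<longlonglongrightarrow> L" for l L
  proof (rule field_le_epsilon)
    fix e :: real assume "e > 0"
    then have "eventually (\<lambda>n. blinfun_apply l (us n) < L + e) sequentially"
      using that by (intro order_tendstoD) auto
    then show "p l \<le> L + e"
      by (intro p_le) (auto simp: R_iff elim: eventually_mono)
  qed
  \<comment> \<open>A linear functional below \<open>p\<close> is bounded, so reflexivity represents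
    it by a point, which a priori depends on \<open>l0\<close>.\<close>
  have *: "\<exists>x. j x = w \<and> blinfun_apply l0 x = p l0" for l0
  proof -
    obtain \<phi> where \<phi>: "linear \<phi>" "\<And>l. \<phi> l \<le> p l" "\<phi> l0 = p l0"
      using hahn_banach_dominated[OF sub] by blast
    have "norm (\<phi> l) \<le> norm l * C" for l
      using \<phi>(2)[of l] \<phi>(2)[of "- l"] linear_neg[OF \<phi>(1), of l] p_le[OF R_bound, of l]
        p_le[OF R_bound, of "- l"] by (simp add: abs_le_iff)
    then have bl: "bounded_linear \<phi>"
      using \<phi>(1) by (intro bounded_linear_intro[where K = C]) (auto simp: linear_add linear_scale)
    obtain x where x: "\<And>l. \<phi> l = blinfun_apply l x"
      using refl unfolding reflexive_banach_def
      by (metis bounded_linear_Blinfun_apply[OF bl])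
    have "norm (j x - w) = 0"
    proof -
      \<comment> \<open>A functional norming \<open>j x - w\<close> is pulled back along
        \<open>j\<close>. Domination by the upper limit bounds its value at \<open>j x\<close> by
        its value at \<open>w\<close>, so the norm is 0.\<close>
      obtain k :: "'w \<Rightarrow>\<^sub>L real" where k: "blinfun_apply k (j x - w) = norm (j x - w)"
        using norming_functional by blast
      define kj where "kj = Blinfun (\<lambda>x. blinfun_apply k (j x))"
      have "bounded_linear (\<lambda>x. blinfun_apply k (j x))"
        by (rule bounded_linear_compose[OF blinfun.bounded_linear_right j(1)])
      then have kj: "blinfun_apply kj y = blinfun_apply k (j y)" for y
        by (simp add: kj_def bounded_linear_Blinfun_apply)
      have "(\<lambda>n. blinfun_apply k (j (us n))) \<longlonglongrightarrow> blinfun_apply k w"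
        by (intro tendsto_intros lim)
      then have "p kj \<le> blinfun_apply k w" by (intro p_lim) (simp add: kj)
      then have "blinfun_apply k (j x) \<le> blinfun_apply k w"
        using \<phi>(2)[of kj] x[of kj] by (simp add: kj)
      then show ?thesis using k norm_ge_zero[of "j x - w"] unfolding blinfun.diff_right by linarith
    qed
    then show ?thesis using x[of l0] \<phi>(3) by auto
  qed
  obtain u where u: "j u = w" using * by blast
  \<comment> \<open>Injectivity of \<open>j\<close> makes all representing points coincide. Upper
    limits along \<open>l\<close> and \<open>- l\<close> then give both halves of
    convergence.\<close>
  have p_u: "p l = blinfun_apply l u" for l
    using *[of l] u j(2) by (metis injD)
  have up: "eventually (\<lambda>n. blinfun_apply l (us n) < y) sequentially"
    if "blinfun_apply l u < y" for l :: "'x \<Rightarrow>\<^sub>L real" and y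
  proof -
    have "p l < y" using that p_u[of l] by simp
    then obtain r where "r \<in> R l" "r < y" using p_ge by (meson not_le)
    then show ?thesis by (auto simp: R_iff elim: eventually_mono)
  qed
  have "(\<lambda>n. blinfun_apply l (us n)) \<longlonglongrightarrow> blinfun_apply l u" for l :: "'x \<Rightarrow>\<^sub>L real"
  proof (rule order_tendstoI)
    fix y assume "y < blinfun_apply l u"
    then show "eventually (\<lambda>n. y < blinfun_apply l (us n)) sequentially"
      using up[of "- l" "- y"] by (simp add: uminus_blinfun.rep_eq)
  qed (rule up)
  then show ?thesis using that[OF u] by (simp add: weakly_converges_def)
qed

section \<open>Ekeland's principle and deformations along compact sets\<close>

text \<open>Each step moves to a point of the current set \<open>T\<close> where \<open>F\<close> is
  minimal up to a power of 1/2. The decrease of \<open>F\<close> makes the sequence Cauchy, and its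
  limit admits no competitor. Lower semicontinuity has the form in which a supremum of continuous
  functions provides it.\<close>

theorem ekeland:
  fixes F :: "'a::metric_space \<Rightarrow> real"
  assumes P: "complete P" "x0 \<in> P" and e: "e > 0"
    and bdd: "\<And>x. x \<in> P \<Longrightarrow> c \<le> F x"
    and lsc: "\<And>s l r. (\<And>n. s n \<in> P) \<Longrightarrow> l \<in> P \<Longrightarrow> s \<longlonglongrightarrow> l \<Longrightarrow> (\<And>n. F (s n) \<le> r) \<Longrightarrow> F l \<le> r"
  obtains x where "x \<in> P" "F x + e * dist x0 x \<le> F x0"
    "\<And>y. y \<in> P \<Longrightarrow> F y + e * dist x y \<le> F x \<Longrightarrow> y = x"
proof -
  define T where "T x = {y \<in> P. F y + e * dist x y \<le> F x}" for x
  have T_trans: "z \<in> T x" if "y \<in> T x" "z \<in> T y" for x y z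
  proof -
    have "e * dist x z \<le> e * dist x y + e * dist y z"
      using e dist_triangle[of x z y] by (simp flip: distrib_left)
    then show ?thesis using that by (auto simp: T_def)
  qed
  have "\<exists>y. y \<in> T x \<and> (\<forall>z\<in>T x. F y \<le> F z + (1/2) ^ n)" if "x \<in> P" for x n
  proof (rule ccontr)
    assume "\<not> ?thesis"
    \<comment> \<open>Losses of \<open>(1/2) ^ n\<close> could then be repeated inside
      \<open>T x\<close> until \<open>F\<close> falls below \<open>c\<close>.\<close>
    then have *: "\<And>y. y \<in> T x \<Longrightarrow> \<exists>z\<in>T x. F z + (1/2) ^ n < F y" by force
    have "\<exists>y\<in>T x. F y \<le> F x - real k * (1/2) ^ n" for k
    proof (induction k)
      case 0 show ?case using that by (auto simp: T_def)
    next
      case (Suc k) then show ?case using * by (force simp: algebra_simps)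
    qed
    note descent = this
    obtain k where "F x - c < real k * (1/2) ^ n"
      using ex_less_of_nat_mult[of "(1/2) ^ n :: real" "F x - c"] by auto
    moreover obtain y where "y \<in> T x" "F y \<le> F x - real k * (1/2) ^ n" using descent by blast
    ultimately have "F y < c" by linarith
    with \<open>y \<in> T x\<close> show False using bdd by (force simp: T_def)
  qed
  then obtain stp where nxt: "\<And>x n. x \<in> P \<Longrightarrow> stp x n \<in> T x"
      "\<And>x n z. x \<in> P \<Longrightarrow> z \<in> T x \<Longrightarrow> F (stp x n) \<le> F z + (1/2) ^ n"
    by metis
  define s where "s = rec_nat x0 (\<lambda>n x. stp x n)"
  have s_Suc: "s (Suc n) = stp (s n) n" and s_0: "s 0 = x0" for n by (simp_all add: s_def)
  have sP: "s n \<in> P" for n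
    by (induction n) (use P nxt(1) in \<open>auto simp: s_0 s_Suc T_def\<close>)
  have s_T: "s m \<in> T (s n)" if "n \<le> m" for n m
    using that
  proof (induction m rule: dec_induct)
    case base show ?case using sP by (simp add: T_def)
  next
    case (step m) then show ?case using T_trans nxt(1) sP s_Suc by metis
  qed
  have "decseq (\<lambda>n. F (s n))"
  proof (rule decseq_SucI)
    fix n
    have "0 \<le> e * dist (s n) (s (Suc n))" using e by simp
    then show "F (s (Suc n)) \<le> F (s n)" using s_T[of n "Suc n"] unfolding T_def by simp
  qed
  then obtain L where L: "(\<lambda>n. F (s n)) \<longlonglongrightarrow> L" "\<And>n. L \<le> F (s n)"
    using decseq_convergent[of "\<lambda>n. F (s n)" c] bdd sP by metis
  have "Cauchy s"
  proof (rule metric_CauchyI)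
    fix d :: real assume d: "d > 0"
    have "eventually (\<lambda>n. F (s n) < L + e * d / 2) sequentially"
      using L(1) d e by (intro order_tendstoD) auto
    then obtain N where N: "F (s N) < L + e * d / 2" by (auto simp: eventually_sequentially)
    have "dist (s N) (s n) < d / 2" if "n \<ge> N" for n
    proof -
      have "e * dist (s N) (s n) < e * (d / 2)"
        using s_T[OF that] N L(2)[of n] by (simp add: T_def)
      then show ?thesis using e by (simp only: mult_less_cancel_left_pos)
    qed
    then have "dist (s m) (s n) < d" if "m \<ge> N" "n \<ge> N" for m n
      using that by (meson dist_triangle_half_r)
    then show "\<exists>M. \<forall>m\<ge>M. \<forall>n\<ge>M. dist (s m) (s n) < d" by blast
  qed
  then obtain x where x: "x \<in> P" "s \<longlonglongrightarrow> x"
    using P(1) sP by (auto simp: complete_def)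
  have xT: "x \<in> T (s n)" for n
  proof -
    have "F x + e * dist (s n) x \<le> F (s n)"
    proof (rule field_le_epsilon)
      fix d :: real assume d: "d > 0"
      have "(\<lambda>k. e * dist (s n) (s k)) \<longlonglongrightarrow> e * dist (s n) x"
        by (intro tendsto_intros x)
      then have "eventually (\<lambda>k. e * dist (s n) (s k) > e * dist (s n) x - d) sequentially"
        using d by (intro order_tendstoD) auto
      then obtain N where N: "\<And>k. k \<ge> N \<Longrightarrow> e * dist (s n) (s k) > e * dist (s n) x - d"
        by (auto simp: eventually_sequentially)
      \<comment> \<open>The shift by \<open>N + n\<close> serves two ends: beyond \<open>N\<close>
        the distance to \<open>s n\<close> is nearly that of the limit, and beyond \<open>n\<close>
        the terms lie in \<open>T (s n)\<close>.\<close>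
      have "F x \<le> F (s n) - e * dist (s n) x + d"
      proof (rule lsc[of "\<lambda>k. s (k + (N + n))"])
        show "(\<lambda>k. s (k + (N + n))) \<longlonglongrightarrow> x" using x(2) by (rule LIMSEQ_ignore_initial_segment)
        show "F (s (k + (N + n))) \<le> F (s n) - e * dist (s n) x + d" for k
          using N[of "k + (N + n)"] s_T[of n "k + (N + n)"] by (simp add: T_def)
      qed (use sP x in auto)
      then show "F x + e * dist (s n) x \<le> F (s n) + d" by simp
    qed
    then show ?thesis using x by (simp add: T_def)
  qed
  show ?thesis
  proof (rule that[of x])
    show "x \<in> P" by fact
    show "F x + e * dist x0 x \<le> F x0" using xT[of 0] by (simp add: T_def s_0)
  next
    fix y assume y: "y \<in> P" "F y + e * dist x y \<le> F x"
    then have "y \<in> T x" by (simp add: T_def)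
    \<comment> \<open>In every \<open>T (s n)\<close> the point \<open>s (Suc n)\<close> is minimal
      up to \<open>(1/2) ^ n\<close>; in the limit \<open>F x \<le> F y\<close>, which forces zero
      distance.\<close>
    then have "y \<in> T (s n)" for n using T_trans xT by blast
    then have "F (s (Suc n)) \<le> F y + (1/2) ^ n" for n
      using nxt(2)[OF sP] by (simp add: s_Suc)
    moreover have "F x \<le> F (s (Suc n))" for n
    proof -
      have "0 \<le> e * dist (s (Suc n)) x" using e by simp
      then show ?thesis using xT[of "Suc n"] unfolding T_def by simp
    qed
    ultimately have "F x \<le> F y + (1/2) ^ n" for n by (meson order_trans)
    moreover have "(\<lambda>n. F y + (1/2::real) ^ n) \<longlonglongrightarrow> F y + 0"
      by (intro tendsto_intros) auto
    ultimately have "F x \<le> F y" by (intro LIMSEQ_le_const) auto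
    with y(2) have "e * dist x y \<le> 0" by simp
    then show "y = x" using e by (simp add: mult_le_0_iff)
  qed
qed


text \<open>The condition defining the weak slope, for a continuous real function on \<open>E\<close>: the epigraph variable
  of the deformation is not needed then.\<close>

definition descends :: "'y::metric_space set \<Rightarrow> ('y \<Rightarrow> real) \<Rightarrow> real \<Rightarrow> 'y \<Rightarrow> bool" where
  "descends E \<phi> \<sigma> p \<longleftrightarrow> (\<exists>\<delta>>0. \<exists>\<eta>. continuous_on ((ball p \<delta> \<inter> E) \<times> {0..\<delta>}) \<eta> \<and>
     (\<forall>y\<in>ball p \<delta> \<inter> E. \<forall>t\<in>{0..\<delta>}. \<eta> (y, t) \<in> E \<and> dist (\<eta> (y, t)) y \<le> t \<and>
        \<phi> (\<eta> (y, t)) \<le> \<phi> y - \<sigma> * t))"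

section \<open>Patching local descents along a compact set\<close>

lemma descends_mono:
  assumes "descends E \<phi> \<sigma> p" "\<tau> \<le> \<sigma>" shows "descends E \<phi> \<tau> p"
proof -
  obtain \<delta> \<eta> where \<eta>: "\<delta> > 0" "continuous_on ((ball p \<delta> \<inter> E) \<times> {0..\<delta>}) \<eta>"
      "\<And>y t. y \<in> ball p \<delta> \<inter> E \<Longrightarrow> t \<in> {0..\<delta>} \<Longrightarrow> \<eta> (y, t) \<in> E \<and> dist (\<eta> (y, t)) y \<le> t \<and>
        \<phi> (\<eta> (y, t)) \<le> \<phi> y - \<sigma> * t"
    using assms(1) unfolding descends_def by blast
  have "\<phi> (\<eta> (y, t)) \<le> \<phi> y - \<tau> * t" if "y \<in> ball p \<delta> \<inter> E" "t \<in> {0..\<delta>}" for y t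
    using \<eta>(3)[OF that] mult_right_mono[OF assms(2), of t] that(2) by simp
  then show ?thesis unfolding descends_def using \<eta> by blast
qed

text \<open>The local deformations are composed, the one of index \<open>i\<close> running for time
  \<open>t * w i x\<close>. The weights sum to at most 1, so the total displacement is at most
  \<open>t\<close>; as \<open>g x\<close> is within \<open>\<delta> i / 2\<close> of
  \<open>p i\<close> on \<open>N i\<close>, the moved point stays where \<open>\<eta> i\<close> is
  available.\<close>

lemma deform_finitely_often:
  fixes g :: "'p::metric_space \<Rightarrow> 'y::metric_space"
  assumes fin: "finite I" and g: "continuous_on UNIV g" "\<And>x. g x \<in> E"
    and \<eta>: "\<And>i. i \<in> I \<Longrightarrow> continuous_on ((ball (p i) (\<delta> i) \<inter> E) \<times> {0..\<delta> i}) (\<eta> i)"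
      "\<And>i y s. i \<in> I \<Longrightarrow> y \<in> ball (p i) (\<delta> i) \<inter> E \<Longrightarrow> s \<in> {0..\<delta> i} \<Longrightarrow>
         \<eta> i (y, s) \<in> E \<and> dist (\<eta> i (y, s)) y \<le> s \<and> \<phi> (\<eta> i (y, s)) \<le> \<phi> y - \<sigma> * s"
    and N: "\<And>i. i \<in> I \<Longrightarrow> closed (N i)"
      "\<And>i x. i \<in> I \<Longrightarrow> x \<in> N i \<Longrightarrow> dist (p i) (g x) < \<delta> i / 2"
    and w: "\<And>i. i \<in> I \<Longrightarrow> continuous_on UNIV (w i)" "\<And>i x. i \<in> I \<Longrightarrow> 0 \<le> w i x"
      "\<And>i. i \<in> I \<Longrightarrow> closed {x. x \<in> N i \<longrightarrow> w i x = 0}"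
      "\<And>i x. i \<in> I \<Longrightarrow> x \<notin> N i \<Longrightarrow> w i x = 0"
      "\<And>x. (\<Sum>i\<in>I. w i x) \<le> 1"
    and t: "0 \<le> t" "\<And>i. i \<in> I \<Longrightarrow> t \<le> \<delta> i / 2"
  shows "\<exists>g'. continuous_on UNIV g' \<and> (\<forall>x. g' x \<in> E \<and> dist (g' x) (g x) \<le> t * (\<Sum>i\<in>I. w i x) \<and>
     \<phi> (g' x) \<le> \<phi> (g x) - \<sigma> * (t * (\<Sum>i\<in>I. w i x)))"
  using fin \<eta> N w t(2)
proof (induction I rule: finite_induct)
  case empty
  then show ?case using g by (intro exI[of _ g]) auto
next
  case (insert i I)
  have sum: "(\<Sum>i\<in>insert i I. w i x) = w i x + (\<Sum>i\<in>I. w i x)" for x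
    using insert.hyps by simp
  have I0: "0 \<le> (\<Sum>i\<in>I. w i x)" for x using insert.prems(6) by (auto intro: sum_nonneg)
  have w1: "w i x \<le> 1" "(\<Sum>i\<in>I. w i x) \<le> 1" for x
    using insert.prems(9)[of x] insert.prems(6)[of i x] I0[of x] unfolding sum by auto
  have "\<exists>g'. continuous_on UNIV g' \<and> (\<forall>x. g' x \<in> E \<and> dist (g' x) (g x) \<le> t * (\<Sum>i\<in>I. w i x) \<and>
     \<phi> (g' x) \<le> \<phi> (g x) - \<sigma> * (t * (\<Sum>i\<in>I. w i x)))"
  proof (rule insert.IH)
    show "continuous_on ((ball (p j) (\<delta> j) \<inter> E) \<times> {0..\<delta> j}) (\<eta> j)" if "j \<in> I" for j
      by (rule insert.prems(1)) (use that in simp)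
    show "\<eta> j (y, s) \<in> E \<and> dist (\<eta> j (y, s)) y \<le> s \<and> \<phi> (\<eta> j (y, s)) \<le> \<phi> y - \<sigma> * s"
      if "j \<in> I" "y \<in> ball (p j) (\<delta> j) \<inter> E" "s \<in> {0..\<delta> j}" for j y s
      by (rule insert.prems(2)) (use that in simp_all)
  qed (use insert.prems(3-8,10) w1(2) in \<open>simp_all\<close>)
  then obtain h where h: "continuous_on UNIV h" "\<And>x. h x \<in> E"
      "\<And>x. dist (h x) (g x) \<le> t * (\<Sum>i\<in>I. w i x)"
      "\<And>x. \<phi> (h x) \<le> \<phi> (g x) - \<sigma> * (t * (\<Sum>i\<in>I. w i x))" by blast
  have \<delta>: "t \<le> \<delta> i / 2" using insert.prems by simp
  have h_ball: "h x \<in> ball (p i) (\<delta> i) \<inter> E" if "x \<in> N i" for x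
  proof -
    have "dist (h x) (g x) \<le> t" using h(3)[of x] mult_left_mono[OF w1(2)[of x] t(1)] by simp
    then have "dist (p i) (h x) < \<delta> i"
      using insert.prems(4)[of i x] that \<delta> dist_triangle[of "p i" "h x" "g x"]
      by (simp add: dist_commute)
    then show ?thesis using h(2) by simp
  qed
  have s: "t * w i x \<in> {0..\<delta> i}" for x
    using t(1) \<delta> w1(1)[of x] insert.prems(6)[of i x] mult_left_mono[OF w1(1)[of x] t(1)]
    by auto
  define g' where "g' x = (if x \<in> N i then \<eta> i (h x, t * w i x) else h x)" for x
  note \<eta>i = insert.prems(2)[of i, OF insertI1]
  \<comment> \<open>At time 0 the displacement bound makes \<open>\<eta> i\<close> the identity, so
    the branches of \<open>g'\<close> agree where they overlap.\<close>
  have still: "\<eta> i (h x, t * w i x) = h x" if "x \<in> N i" "w i x = 0" for x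
    using \<eta>i[OF h_ball[OF that(1)] s[of x]] that(2) by simp
  have "continuous_on UNIV g'"
  proof -
    \<comment> \<open>\<open>?Z\<close> enlarges the complement of \<open>N i\<close> to a closed
      set, which allows pasting over two closed sets.\<close>
    let ?Z = "{x. x \<in> N i \<longrightarrow> w i x = 0}"
    have "continuous_on (N i \<union> ?Z) g'"
      unfolding g'_def
    proof (rule continuous_on_cases)
      show "closed (N i)" "closed ?Z" using insert.prems by auto
      show "continuous_on (N i) (\<lambda>x. \<eta> i (h x, t * w i x))"
      proof (rule continuous_on_compose2[OF insert.prems(1)[of i]])
        show "continuous_on (N i) (\<lambda>x. (h x, t * w i x))"
          by (intro continuous_intros continuous_on_subset[OF h(1)]
                continuous_on_subset[OF insert.prems(5)[of i]]) auto
        show "(\<lambda>x. (h x, t * w i x)) ` N i \<subseteq> (ball (p i) (\<delta> i) \<inter> E) \<times> {0..\<delta> i}"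
          using h_ball s by blast
      qed simp
      show "continuous_on ?Z h" by (rule continuous_on_subset[OF h(1)]) simp
      show "\<forall>x. x \<in> N i \<and> x \<notin> N i \<or> x \<in> ?Z \<and> x \<in> N i \<longrightarrow> \<eta> i (h x, t * w i x) = h x"
        using still by auto
    qed
    moreover have "N i \<union> ?Z = UNIV" by auto
    ultimately show ?thesis by simp
  qed
  moreover have "g' x \<in> E \<and> dist (g' x) (g x) \<le> t * (\<Sum>i\<in>insert i I. w i x) \<and>
     \<phi> (g' x) \<le> \<phi> (g x) - \<sigma> * (t * (\<Sum>i\<in>insert i I. w i x))" for x
  proof -
    have "g' x \<in> E \<and> dist (g' x) (h x) \<le> t * w i x \<and> \<phi> (g' x) \<le> \<phi> (h x) - \<sigma> * (t * w i x)"
      using \<eta>i[OF h_ball[of x] s[of x]] h(2) insert.prems(8)[of i x]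
      by (cases "x \<in> N i") (auto simp: g'_def)
    then show ?thesis
      unfolding sum using h(3,4)[of x] dist_triangle[of "g' x" "g x" "h x"]
      by (auto simp: algebra_simps)
  qed
  ultimately show ?case by blast
qed


text \<open>Finitely many balls cover \<open>K\<close> on which \<open>g\<close> stays near the
  image of the centre; tent functions on them give the weights. Their sum is 1 on \<open>K\<close>,
  which yields the full descent there, and 0 off \<open>U\<close>.\<close>

lemma deform_on_compact:
  fixes g :: "'p::metric_space \<Rightarrow> 'y::metric_space"
  assumes g: "continuous_on UNIV g" "\<And>x. g x \<in> E"
    and K: "compact K" "open U" "K \<subseteq> U" and desc: "\<And>x. x \<in> K \<Longrightarrow> descends E \<phi> \<sigma> (g x)" and \<sigma>: "0 \<le> \<sigma>"
  obtains T where "T > 0" "\<And>t. 0 \<le> t \<Longrightarrow> t \<le> T \<Longrightarrow> \<exists>g'. continuous_on UNIV g' \<and>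
     (\<forall>x. g' x \<in> E \<and> dist (g' x) (g x) \<le> t \<and> \<phi> (g' x) \<le> \<phi> (g x) \<and>
        (x \<in> K \<longrightarrow> \<phi> (g' x) \<le> \<phi> (g x) - \<sigma> * t) \<and> (x \<notin> U \<longrightarrow> g' x = g x))"
proof -
  have "\<forall>x\<in>K. \<exists>\<delta> \<eta> r. \<delta> > 0 \<and> continuous_on ((ball (g x) \<delta> \<inter> E) \<times> {0..\<delta>}) \<eta> \<and>
     (\<forall>y\<in>ball (g x) \<delta> \<inter> E. \<forall>t\<in>{0..\<delta>}. \<eta> (y, t) \<in> E \<and> dist (\<eta> (y, t)) y \<le> t \<and>
        \<phi> (\<eta> (y, t)) \<le> \<phi> y - \<sigma> * t) \<and>
     r > 0 \<and> cball x r \<subseteq> U \<inter> g -` ball (g x) (\<delta> / 2)"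
  proof
    fix x assume x: "x \<in> K"
    obtain \<delta> \<eta> where \<eta>: "\<delta> > 0" "continuous_on ((ball (g x) \<delta> \<inter> E) \<times> {0..\<delta>}) \<eta>"
      "\<forall>y\<in>ball (g x) \<delta> \<inter> E. \<forall>t\<in>{0..\<delta>}. \<eta> (y, t) \<in> E \<and> dist (\<eta> (y, t)) y \<le> t \<and>
        \<phi> (\<eta> (y, t)) \<le> \<phi> y - \<sigma> * t"
      using desc[OF x] unfolding descends_def by blast
    have "open (U \<inter> g -` ball (g x) (\<delta> / 2))"
      using K(2) g(1) by (intro open_Int open_vimage) (auto simp: continuous_on_eq_continuous_at)
    moreover have "x \<in> U \<inter> g -` ball (g x) (\<delta> / 2)" using x K \<eta>(1) by auto
    ultimately obtain r where "r > 0" "cball x r \<subseteq> U \<inter> g -` ball (g x) (\<delta> / 2)"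
      by (meson open_contains_cball)
    then show "\<exists>\<delta> \<eta> r. \<delta> > 0 \<and> continuous_on ((ball (g x) \<delta> \<inter> E) \<times> {0..\<delta>}) \<eta> \<and>
     (\<forall>y\<in>ball (g x) \<delta> \<inter> E. \<forall>t\<in>{0..\<delta>}. \<eta> (y, t) \<in> E \<and> dist (\<eta> (y, t)) y \<le> t \<and>
        \<phi> (\<eta> (y, t)) \<le> \<phi> y - \<sigma> * t) \<and>
     r > 0 \<and> cball x r \<subseteq> U \<inter> g -` ball (g x) (\<delta> / 2)" using \<eta> by blast
  qed
  then obtain \<delta> \<eta> r where \<eta>: "\<And>x. x \<in> K \<Longrightarrow> \<delta> x > 0"
      "\<And>x. x \<in> K \<Longrightarrow> continuous_on ((ball (g x) (\<delta> x) \<inter> E) \<times> {0..\<delta> x}) (\<eta> x)"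
      "\<And>x y t. x \<in> K \<Longrightarrow> y \<in> ball (g x) (\<delta> x) \<inter> E \<Longrightarrow> t \<in> {0..\<delta> x} \<Longrightarrow>
         \<eta> x (y, t) \<in> E \<and> dist (\<eta> x (y, t)) y \<le> t \<and> \<phi> (\<eta> x (y, t)) \<le> \<phi> y - \<sigma> * t"
      and r: "\<And>x. x \<in> K \<Longrightarrow> r x > 0" "\<And>x. x \<in> K \<Longrightarrow> cball x (r x) \<subseteq> U \<inter> g -` ball (g x) (\<delta> x / 2)"
    unfolding bchoice_iff by blast
  obtain I where I: "I \<subseteq> K" "finite I" "K \<subseteq> (\<Union>i\<in>I. ball i (r i))"
  proof (rule compactE_image[OF K(1)])
    show "K \<subseteq> (\<Union>i\<in>K. ball i (r i))" using r(1) by auto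
  qed auto
  define b where "b i x = max 0 (r i - dist i x)" for i x
  define B where "B x = (\<Sum>i\<in>I. b i x)" for x
  have b_cont: "continuous_on A (b i)" for A i
    unfolding b_def by (intro continuous_intros)
  have B_cont: "continuous_on A B" for A
    unfolding B_def by (intro continuous_intros b_cont)
  have B_pos: "B x > 0" if "x \<in> K" for x
  proof -
    from I(3) that obtain i where "i \<in> I" "x \<in> ball i (r i)" by blast
    then show ?thesis unfolding B_def by (intro sum_pos2[of I i]) (auto simp: b_def I)
  qed
  \<comment> \<open>Dividing by \<open>max m (B x)\<close> instead of \<open>B x\<close> keeps the
    weights continuous where all tents vanish, and their sum is still 1 on \<open>K\<close>.\<close>
  obtain m where m: "m > 0" "\<And>x. x \<in> K \<Longrightarrow> m \<le> B x"
  proof (cases "K = {}")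
    case False
    then obtain x where "x \<in> K" "\<And>y. y \<in> K \<Longrightarrow> B x \<le> B y"
      using continuous_attains_inf[OF K(1) _ B_cont] by blast
    then show ?thesis using that B_pos by blast
  qed (use that[of 1] in auto)
  define w where "w i x = b i x / max m (B x)" for i x
  have w_cont: "continuous_on A (w i)" for A i
    unfolding w_def using m(1) by (intro continuous_intros b_cont B_cont) (auto simp: max_def)
  have mB: "max m (B x) > 0" for x using m(1) by (simp add: less_max_iff_disj)
  have w_nonneg: "0 \<le> w i x" for i x using mB[of x] by (simp add: w_def b_def)
  have w_iff: "w i x = 0 \<longleftrightarrow> r i \<le> dist i x" for i x
    using mB[of x] by (auto simp: w_def b_def max_def)
  have w_sum: "(\<Sum>i\<in>I. w i x) = B x / max m (B x)" for x
    by (simp add: w_def B_def sum_divide_distrib)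
  \<comment> \<open>The inserted 1 keeps the minimum meaningful when \<open>I\<close> is
    empty.\<close>
  define T where "T = Min (insert 1 ((\<lambda>i. \<delta> i / 2) ` I))"
  have "T > 0" unfolding T_def using I \<eta>(1) by (auto simp: Min_gr_iff)
  have T: "T \<le> \<delta> i / 2" if "i \<in> I" for i
    unfolding T_def by (rule Min_le) (use I that in auto)
  show ?thesis
  proof (rule that[OF \<open>T > 0\<close>])
    fix t assume t: "0 \<le> t" "t \<le> T"
    have le1: "(\<Sum>i\<in>I. w i x) \<le> 1" for x using mB[of x] by (simp add: w_sum)
    have "\<exists>g'. continuous_on UNIV g' \<and> (\<forall>x. g' x \<in> E \<and> dist (g' x) (g x) \<le> t * (\<Sum>i\<in>I. w i x) \<and>
        \<phi> (g' x) \<le> \<phi> (g x) - \<sigma> * (t * (\<Sum>i\<in>I. w i x)))"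
    proof (rule deform_finitely_often[where p = g and \<delta> = \<delta> and \<eta> = \<eta> and N = "\<lambda>i. cball i (r i)"])
      show "closed {x. x \<in> cball i (r i) \<longrightarrow> w i x = 0}" for i
      proof -
        have "{x. x \<in> cball i (r i) \<longrightarrow> w i x = 0} = {x. r i \<le> dist i x}"
          by (auto simp: w_iff)
        also have "closed \<dots>" by (intro closed_Collect_le continuous_intros)
        finally show ?thesis .
      qed
      show "dist (g i) (g x) < \<delta> i / 2" if "i \<in> I" "x \<in> cball i (r i)" for i x
      proof -
        have "i \<in> K" using that I by blast
        then have "x \<in> g -` ball (g i) (\<delta> i / 2)" using r(2) that(2) by blast
        then show ?thesis by simp
      qed
      show "t \<le> \<delta> i / 2" if "i \<in> I" for i using T[OF that] t by simp
      show "w i x = 0" if "x \<notin> cball i (r i)" for i x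
        using that by (simp add: w_iff)
    qed (use I \<eta> in \<open>simp_all add: g w_cont w_nonneg le1 t subset_iff\<close>)
    then obtain g' where g': "continuous_on UNIV g'" "\<And>x. g' x \<in> E"
      "\<And>x. dist (g' x) (g x) \<le> t * (\<Sum>i\<in>I. w i x)"
      "\<And>x. \<phi> (g' x) \<le> \<phi> (g x) - \<sigma> * (t * (\<Sum>i\<in>I. w i x))" by blast
    have "dist (g' x) (g x) \<le> t" for x
      using g'(3)[of x] mult_left_mono[OF le1[of x] t(1)] by simp
    moreover have "\<phi> (g' x) \<le> \<phi> (g x)" for x
    proof -
      have "0 \<le> \<sigma> * (t * (\<Sum>i\<in>I. w i x))" using \<sigma> t w_nonneg by (simp add: sum_nonneg)
      then show ?thesis using g'(4)[of x] by linarith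
    qed
    moreover have "\<phi> (g' x) \<le> \<phi> (g x) - \<sigma> * t" if "x \<in> K" for x
    proof -
      have "(\<Sum>i\<in>I. w i x) = 1" using m(1) m(2)[OF that] by (simp add: w_sum max_def)
      then show ?thesis using g'(4)[of x] by simp
    qed
    moreover have "g' x = g x" if "x \<notin> U" for x
    proof -
      have "w i x = 0" if "i \<in> I" for i
        using r(2)[of i] \<open>x \<notin> U\<close> that I unfolding w_iff by force
      then show ?thesis using g'(3)[of x] by simp
    qed
    ultimately show "\<exists>g'. continuous_on UNIV g' \<and>
     (\<forall>x. g' x \<in> E \<and> dist (g' x) (g x) \<le> t \<and> \<phi> (g' x) \<le> \<phi> (g x) \<and>
        (x \<in> K \<longrightarrow> \<phi> (g' x) \<le> \<phi> (g x) - \<sigma> * t) \<and> (x \<notin> U \<longrightarrow> g' x = g x))"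
      using g'(1,2) by blast
  qed
qed

section \<open>Minimax over maps with prescribed values off the open ball\<close>

lemma tendsto_apply_bcontfun:
  assumes "(s \<longlongrightarrow> l) F" shows "((\<lambda>n. apply_bcontfun (s n) x) \<longlongrightarrow> apply_bcontfun l x) F"
proof (rule tendstoI)
  fix e :: real assume "e > 0"
  then have "eventually (\<lambda>n. dist (s n) l < e) F" using assms by (rule tendstoD[rotated])
  then show "eventually (\<lambda>n. dist (apply_bcontfun (s n) x) (apply_bcontfun l x) < e) F"
    by eventually_elim (meson dist_bounded le_less_trans)
qed

text \<open>Ekeland's principle for the maximal height \<open>F\<close> gives a map that cannot be
  lowered at rate \<open>\<epsilon>\<close>. If all its high points descended at rate
  \<open>2 * \<epsilon>\<close>, a deformation by \<open>t\<close> would lower \<open>F\<close> by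
  \<open>2 * \<epsilon> * t\<close>. Competitors live on the whole space, so that they form a closed
  set in the complete space of bounded continuous maps.\<close>

theorem almost_critical_point_near_minimax_map:
  fixes g0 :: "'p::euclidean_space \<Rightarrow>\<^sub>C 'y::complete_space"
  assumes E: "closed E" and \<phi>: "continuous_on UNIV \<phi>" and pos: "\<epsilon> > 0" "\<eta> > 0"
    and g0: "\<And>x. apply_bcontfun g0 x \<in> E" "\<And>x. \<phi> (apply_bcontfun g0 x) \<le> c + \<epsilon>\<^sup>2"
      "\<And>x. norm x \<ge> 1 \<Longrightarrow> \<phi> (apply_bcontfun g0 x) < c - \<eta>"
    and low: "\<And>g. continuous_on UNIV g \<Longrightarrow> (\<And>x. g x \<in> E) \<Longrightarrow>
      (\<And>x. norm x \<ge> 1 \<Longrightarrow> g x = apply_bcontfun g0 x) \<Longrightarrow> \<exists>x\<in>cball 0 1. c \<le> \<phi> (g x)"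
  obtains x y where "y \<in> E" "dist y (apply_bcontfun g0 x) \<le> \<epsilon>" "c - \<eta> \<le> \<phi> y" "\<phi> y \<le> c + \<epsilon>\<^sup>2"
    "\<not> descends E \<phi> (2 * \<epsilon>) y"
proof -
  define P where "P = {g. (\<forall>x. apply_bcontfun g x \<in> E) \<and>
      (\<forall>x. norm x \<ge> 1 \<longrightarrow> apply_bcontfun g x = apply_bcontfun g0 x)}"
  define F where "F g = (SUP x\<in>cball 0 1. \<phi> (apply_bcontfun g x))" for g :: "'p \<Rightarrow>\<^sub>C 'y"
  have \<phi>_cont: "continuous_on A (\<lambda>x. \<phi> (apply_bcontfun g x))" for g :: "'p \<Rightarrow>\<^sub>C 'y" and A
    by (rule continuous_on_compose2[OF \<phi>]) (auto intro: continuous_intros)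
  have F_ge: "\<phi> (apply_bcontfun g x) \<le> F g" if "x \<in> cball 0 1" for g x
    unfolding F_def using that
    by (intro cSUP_upper bounded_imp_bdd_above compact_imp_bounded compact_continuous_image \<phi>_cont) auto
  have F_le: "F g \<le> r" if "\<And>x. x \<in> cball 0 1 \<Longrightarrow> \<phi> (apply_bcontfun g x) \<le> r" for g r
    unfolding F_def by (rule cSUP_least) (use that in auto)
  have "closed P"
  proof (unfold closed_sequential_limits, intro allI impI, elim conjE)
    fix s l assume s: "\<forall>n. s n \<in> P" and l: "s \<longlonglongrightarrow> l"
    note ev = tendsto_apply_bcontfun[OF l]
    have "apply_bcontfun l x \<in> E" for x
      using closed_sequentially[OF E _ ev[of x]] s by (simp add: P_def)
    moreover have "apply_bcontfun l x = apply_bcontfun g0 x" if "norm x \<ge> 1" for x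
      using LIMSEQ_unique[OF ev[of x]] s that by (simp add: P_def)
    ultimately show "l \<in> P" by (simp add: P_def)
  qed
  then have "complete P" by (simp add: complete_eq_closed)
  moreover have "g0 \<in> P" using g0 by (simp add: P_def)
  moreover have "c \<le> F g" if "g \<in> P" for g
  proof -
    have "\<exists>x\<in>cball 0 1. c \<le> \<phi> (apply_bcontfun g x)"
      by (rule low) (use that in \<open>auto simp: P_def intro: continuous_intros\<close>)
    then show ?thesis using F_ge by (meson order_trans)
  qed
  note F_low = this
  moreover have "F l \<le> r" if "s \<longlonglongrightarrow> l" "\<And>n. F (s n) \<le> r" for s l r
  proof (rule F_le)
    fix x :: 'p assume x: "x \<in> cball 0 1"
    have "(\<lambda>n. \<phi> (apply_bcontfun (s n) x)) \<longlonglongrightarrow> \<phi> (apply_bcontfun l x)"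
      by (rule continuous_on_tendsto_compose[OF \<phi> tendsto_apply_bcontfun[OF that(1)]]) auto
    then show "\<phi> (apply_bcontfun l x) \<le> r"
      by (rule LIMSEQ_le_const2) (use F_ge[OF x] that(2) in \<open>meson order_trans\<close>)
  qed
  ultimately obtain g where g: "g \<in> P" "F g + \<epsilon> * dist g0 g \<le> F g0"
      "\<And>h. h \<in> P \<Longrightarrow> F h + \<epsilon> * dist g h \<le> F g \<Longrightarrow> h = g"
    using ekeland[of P g0 \<epsilon> c F] pos(1) by metis
  have Fg0: "F g0 \<le> c + \<epsilon>\<^sup>2" by (rule F_le) (use g0 in auto)
  have c_le: "c \<le> F g" by (rule F_low[OF g(1)])
  have Fg: "F g \<le> c + \<epsilon>\<^sup>2"
  proof -
    have "0 \<le> \<epsilon> * dist g0 g" using pos by simp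
    then show ?thesis using g(2) Fg0 by linarith
  qed
  \<comment> \<open>The initial excess is at most \<open>\<epsilon>\<^sup>2\<close>, and distance is
    charged at rate \<open>\<epsilon>\<close>.\<close>
  have "\<epsilon> * dist g0 g \<le> \<epsilon> * \<epsilon>" using g(2) Fg0 c_le by (simp add: power2_eq_square)
  then have near: "dist g0 g \<le> \<epsilon>" using pos by simp
  \<comment> \<open>The threshold is at least \<open>c - \<eta>\<close>, hence above the values
    prescribed at norm at least 1. So \<open>K\<close> lies in the open ball, and deforming there
    leaves the prescribed values alone.\<close>
  define K where "K = {x \<in> cball 0 1. F g - \<eta> \<le> \<phi> (apply_bcontfun g x)}"
  have K_compact: "compact K"
  proof -
    have "K = cball 0 1 \<inter> {x. F g - \<eta> \<le> \<phi> (apply_bcontfun g x)}" by (auto simp: K_def)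
    then show ?thesis
      by (auto intro!: compact_Int_closed closed_Collect_le \<phi>_cont continuous_intros)
  qed
  have K_ball: "K \<subseteq> ball 0 1"
  proof
    fix x assume x: "x \<in> K"
    have False if "norm x \<ge> 1"
      using g0(3)[OF that] x that g(1) c_le by (auto simp: K_def P_def)
    then show "x \<in> ball 0 1" by force
  qed
  have "\<exists>x\<in>K. \<not> descends E \<phi> (2 * \<epsilon>) (apply_bcontfun g x)"
  proof (rule ccontr)
    assume "\<not> ?thesis"
    then have desc: "\<And>x. x \<in> K \<Longrightarrow> descends E \<phi> (2 * \<epsilon>) (apply_bcontfun g x)" by blast
    have "continuous_on UNIV (apply_bcontfun g)" "\<And>x. apply_bcontfun g x \<in> E" "0 \<le> 2 * \<epsilon>"
      using g(1) pos by (auto simp: P_def intro: continuous_intros)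
    from deform_on_compact[OF this(1,2) K_compact open_ball K_ball desc this(3)]
    obtain T where T: "T > 0" "\<And>t. 0 \<le> t \<Longrightarrow> t \<le> T \<Longrightarrow> \<exists>g'. continuous_on UNIV g' \<and>
     (\<forall>x. g' x \<in> E \<and> dist (g' x) (apply_bcontfun g x) \<le> t \<and> \<phi> (g' x) \<le> \<phi> (apply_bcontfun g x) \<and>
        (x \<in> K \<longrightarrow> \<phi> (g' x) \<le> \<phi> (apply_bcontfun g x) - 2 * \<epsilon> * t) \<and>
        (x \<notin> ball 0 1 \<longrightarrow> g' x = apply_bcontfun g x))" by blast
    \<comment> \<open>Points outside \<open>K\<close> start below \<open>F g - \<eta>\<close> and
      never rise; with \<open>2 * \<epsilon> * t \<le> \<eta>\<close> they also end below
      \<open>F g - 2 * \<epsilon> * t\<close>.\<close>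
    define t where "t = min T (\<eta> / (2 * \<epsilon>))"
    have t: "0 < t" "t \<le> T" "2 * \<epsilon> * t \<le> \<eta>"
    proof -
      have "2 * \<epsilon> * t \<le> 2 * \<epsilon> * (\<eta> / (2 * \<epsilon>))"
        unfolding t_def by (rule mult_left_mono) (use pos in auto)
      then show "2 * \<epsilon> * t \<le> \<eta>" using pos by simp
    qed (use T pos in \<open>auto simp: t_def\<close>)
    obtain g' where g': "continuous_on UNIV g'" "\<And>x. g' x \<in> E"
      "\<And>x. dist (g' x) (apply_bcontfun g x) \<le> t" "\<And>x. \<phi> (g' x) \<le> \<phi> (apply_bcontfun g x)"
      "\<And>x. x \<in> K \<Longrightarrow> \<phi> (g' x) \<le> \<phi> (apply_bcontfun g x) - 2 * \<epsilon> * t"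
      "\<And>x. x \<notin> ball 0 1 \<Longrightarrow> g' x = apply_bcontfun g x"
      using T(2)[of t] t by auto
    have "g' \<in> bcontfun"
    proof -
      have "bounded (range (apply_bcontfun g))" using apply_bcontfun[of g] by (simp add: bcontfun_def)
      then obtain a C where C: "\<And>x. dist a (apply_bcontfun g x) \<le> C" by (auto simp: bounded_def)
      have "dist a (g' x) \<le> C + t" for x
        using C[of x] g'(3)[of x] dist_triangle[of a "g' x" "apply_bcontfun g x"]
        by (simp add: dist_commute)
      then have "bounded (range g')" by (auto simp: bounded_def)
      then show ?thesis using g'(1) by (simp add: bcontfun_def)
    qed
    then obtain h where h: "g' = apply_bcontfun h" by (metis Bcontfun_inverse)
    have hP: "h \<in> P" using g(1) g' unfolding P_def h by auto
    have "dist g h \<le> t" by (rule dist_bound) (use g'(3) h in \<open>simp add: dist_commute\<close>)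
    then have "\<epsilon> * dist g h \<le> \<epsilon> * t" using pos by simp
    moreover have "F h \<le> F g - 2 * \<epsilon> * t"
    proof (rule F_le)
      fix x :: 'p assume x: "x \<in> cball 0 1"
      show "\<phi> (apply_bcontfun h x) \<le> F g - 2 * \<epsilon> * t"
        using g'(4,5)[of x] F_ge[OF x, of g] t(3) x by (cases "x \<in> K") (auto simp: h K_def)
    qed
    moreover have "0 < \<epsilon> * t" using pos t by simp
    ultimately have "F h + \<epsilon> * dist g h \<le> F g" "F h < F g" by linarith+
    then show False using g(3)[OF hP] by blast
  qed
  then obtain x where x: "x \<in> K" "\<not> descends E \<phi> (2 * \<epsilon>) (apply_bcontfun g x)" by blast
  show ?thesis
  proof (rule that)
    show "apply_bcontfun g x \<in> E" using g(1) by (simp add: P_def)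
    show "dist (apply_bcontfun g x) (apply_bcontfun g0 x) \<le> \<epsilon>"
      using near dist_bounded[of g x g0] by (simp add: dist_commute)
    show "c - \<eta> \<le> \<phi> (apply_bcontfun g x)" using x(1) c_le by (simp add: K_def)
    show "\<phi> (apply_bcontfun g x) \<le> c + \<epsilon>\<^sup>2"
      using x(1) F_ge[of x g] Fg by (simp add: K_def)
  qed (fact x(2))
qed

section \<open>Weak slope and epigraph\<close>

text \<open>The stationary deformation is admissible with rate 0, so the supremum is not over the
  empty set.\<close>

lemma weak_slope_nonneg: "0 \<le> weak_slope Y f u"
proof -
  have "ereal 0 \<le> weak_slope Y f u"
    unfolding weak_slope_def
  proof (rule Sup_upper, intro CollectI exI conjI)
    show "continuous_on ((ball (u, real_of_ereal (f u)) 1 \<inter> epi Y f) \<times> {0..1}) (\<lambda>p. fst (fst p))"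
      by (intro continuous_intros)
  qed (auto simp: epi_def zero_ereal_def[symmetric])
  then show ?thesis by (simp add: zero_ereal_def)
qed

text \<open>On the epigraph, moving a point along a descent of \<open>f\<close> costs both a horizontal and a
  vertical displacement; \<open>sqrt (1 + \<sigma>\<^sup>2)\<close> renormalizes the resulting speed to at most one.\<close>

lemma descends_epi_on_graph:
  fixes f :: "'a::metric_space \<Rightarrow> ereal"
  assumes slope: "ereal \<sigma> < weak_slope UNIV f u" and \<sigma>: "0 \<le> \<sigma>"
  shows "descends (epi UNIV f) snd (\<sigma> / sqrt (1 + \<sigma>\<^sup>2)) (u, real_of_ereal (f u))"
proof -
  let ?B = "\<lambda>\<delta>. ball (u, real_of_ereal (f u)) \<delta> \<inter> epi UNIV f"
  obtain \<rho> \<delta> \<H> where \<rho>: "\<sigma> < \<rho>" and \<delta>: "\<delta> > 0"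
    and \<H>: "continuous_on (?B \<delta> \<times> {0..\<delta>}) \<H>"
      "\<And>x \<mu> t. (x, \<mu>) \<in> ?B \<delta> \<Longrightarrow> t \<in> {0..\<delta>} \<Longrightarrow> dist (\<H> ((x, \<mu>), t)) x \<le> t \<and>
         f (\<H> ((x, \<mu>), t)) \<le> f x - ereal (\<rho> * t)"
    using slope unfolding weak_slope_def less_Sup_iff by fastforce
  define k where "k = 1 / sqrt (1 + \<sigma>\<^sup>2)"
  have pos: "0 < 1 + \<sigma>\<^sup>2" by (simp add: add_pos_nonneg)
  have k: "0 < k" "k \<le> 1" "k\<^sup>2 * (1 + \<sigma>\<^sup>2) = 1"
    using pos by (auto simp: k_def power_divide)
  have kt: "k * t \<in> {0..\<delta>}" if "t \<in> {0..\<delta>}" for t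
    using k that mult_mono[of k 1 t \<delta>] by auto
  \<comment> \<open>The deformation runs for the slowed time \<open>k * t\<close> while the height
    drops by \<open>\<sigma> * (k * t)\<close>. The squared displacement is at most
    \<open>(k\<^sup>2 * (1 + \<sigma>\<^sup>2)) * t\<^sup>2\<close>, which is
    \<open>t\<^sup>2\<close>.\<close>
  define \<eta> where "\<eta> p = (\<H> (fst p, k * snd p), snd (fst p) - \<sigma> * (k * snd p))" for p
  have "continuous_on (?B \<delta> \<times> {0..\<delta>}) \<eta>"
    unfolding \<eta>_def
    by (intro continuous_intros continuous_on_compose2[OF \<H>(1)]) (use kt in auto)
  moreover have "\<eta> (y, t) \<in> epi UNIV f \<and> dist (\<eta> (y, t)) y \<le> t \<and>
      snd (\<eta> (y, t)) \<le> snd y - (\<sigma> / sqrt (1 + \<sigma>\<^sup>2)) * t"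
    if y: "y \<in> ?B \<delta>" and t: "t \<in> {0..\<delta>}" for y t
  proof -
    obtain x \<mu> where [simp]: "y = (x, \<mu>)" by (cases y)
    have *: "dist (\<H> ((x, \<mu>), k * t)) x \<le> k * t" "f (\<H> ((x, \<mu>), k * t)) \<le> f x - ereal (\<rho> * (k * t))"
      using \<H>(2)[OF _ kt[OF t], of x \<mu>] y by auto
    have "f x - ereal (\<rho> * (k * t)) \<le> ereal \<mu> - ereal (\<sigma> * (k * t))"
    proof (rule ereal_minus_mono)
      show "f x \<le> ereal \<mu>" using y by (simp add: epi_def)
      show "ereal (\<sigma> * (k * t)) \<le> ereal (\<rho> * (k * t))"
        using \<rho> k t by (auto intro!: mult_right_mono)
    qed
    then have "f (\<H> ((x, \<mu>), k * t)) \<le> ereal (\<mu> - \<sigma> * (k * t))" using *(2) by simp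
    moreover have "dist (\<eta> (y, t)) y \<le> t"
    proof -
      have "(dist (\<H> ((x, \<mu>), k * t)) x)\<^sup>2 + (\<sigma> * (k * t))\<^sup>2 \<le> (k * t)\<^sup>2 + (\<sigma> * (k * t))\<^sup>2"
        using *(1) by (simp add: power_mono)
      also have "\<dots> = (k\<^sup>2 * (1 + \<sigma>\<^sup>2)) * t\<^sup>2" by (simp add: power_mult_distrib algebra_simps)
      also have "\<dots> = t\<^sup>2" by (simp add: k(3))
      finally show ?thesis
        using t by (simp add: \<eta>_def dist_Pair_Pair dist_real_def real_le_lsqrt)
    qed
    ultimately show ?thesis by (simp add: \<eta>_def epi_def k_def)
  qed
  ultimately show ?thesis unfolding descends_def using \<delta> by blast
qed

text \<open>The weak slope supplies a deformation on the epigraph of the height; evaluating it at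
  \<open>(y, snd y)\<close> removes the additional variable.\<close>

lemma descends_epi_above_graph:
  fixes f :: "'a::metric_space \<Rightarrow> ereal"
  assumes "ereal \<sigma> < weak_slope (epi UNIV f) epi_height (u, \<xi>)"
  shows "descends (epi UNIV f) snd \<sigma> (u, \<xi>)"
proof -
  let ?B = "\<lambda>\<delta>. ball ((u, \<xi>), \<xi>) \<delta> \<inter> epi (epi UNIV f) epi_height"
  obtain \<rho> \<delta> \<H> where \<rho>: "\<sigma> < \<rho>" and \<delta>: "\<delta> > 0"
    and \<H>: "continuous_on (?B \<delta> \<times> {0..\<delta>}) \<H>"
      "\<And>x \<mu> t. (x, \<mu>) \<in> ?B \<delta> \<Longrightarrow> t \<in> {0..\<delta>} \<Longrightarrow> \<H> ((x, \<mu>), t) \<in> epi UNIV f \<and>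
         dist (\<H> ((x, \<mu>), t)) x \<le> t \<and>
         epi_height (\<H> ((x, \<mu>), t)) \<le> epi_height x - ereal (\<rho> * t)"
    using assms unfolding weak_slope_def less_Sup_iff epi_height_def by fastforce
  \<comment> \<open>The lifted point may be up to twice as far from its centre as \<open>y\<close>,
    hence the half radius.\<close>
  have in_B: "(y, snd y) \<in> ?B \<delta>" if "y \<in> ball (u, \<xi>) (\<delta> / 2) \<inter> epi UNIV f" for y
  proof -
    have "dist ((u, \<xi>), \<xi>) (y, snd y) \<le> dist (u, \<xi>) y + dist \<xi> (snd y)"
      unfolding dist_Pair_Pair by (rule sqrt_sum_squares_le_sum) auto
    also have "\<dots> \<le> 2 * dist (u, \<xi>) y" using dist_snd_le[of "(u, \<xi>)" y] by simp
    finally show ?thesis using that by (auto simp: epi_def epi_height_def)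
  qed
  define \<eta> where "\<eta> p = \<H> ((fst p, snd (fst p)), snd p)" for p
  have "continuous_on ((ball (u, \<xi>) (\<delta> / 2) \<inter> epi UNIV f) \<times> {0..\<delta> / 2}) \<eta>"
    unfolding \<eta>_def
    by (intro continuous_intros continuous_on_compose2[OF \<H>(1)]) (use in_B \<delta> in auto)
  moreover have "\<eta> (y, t) \<in> epi UNIV f \<and> dist (\<eta> (y, t)) y \<le> t \<and> snd (\<eta> (y, t)) \<le> snd y - \<sigma> * t"
    if y: "y \<in> ball (u, \<xi>) (\<delta> / 2) \<inter> epi UNIV f" and t: "t \<in> {0..\<delta> / 2}" for y t
  proof -
    have "t \<in> {0..\<delta>}" using t by auto
    from \<H>(2)[OF in_B[OF y] this] have "\<eta> (y, t) \<in> epi UNIV f" "dist (\<eta> (y, t)) y \<le> t"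
      "snd (\<eta> (y, t)) \<le> snd y - \<rho> * t"
      by (auto simp: \<eta>_def epi_height_def)
    moreover have "\<sigma> * t \<le> \<rho> * t" using \<rho> t by (auto intro!: mult_right_mono)
    ultimately show ?thesis by simp
  qed
  ultimately show ?thesis unfolding descends_def using \<delta> by (meson half_gt_zero)
qed

lemma closed_epi:
  fixes f :: "'a::metric_space \<Rightarrow> ereal"
  assumes "lower_semicontinuous f" shows "closed (epi UNIV f)"
proof (unfold closed_sequential_limits, intro allI impI, elim conjE)
  fix s and l :: "'a \<times> real" assume s: "\<forall>n. s n \<in> epi UNIV f" and l: "s \<longlonglongrightarrow> l"
  have "f (fst l) \<le> ereal (snd l)"
  proof (rule ccontr)
    assume "\<not> ?thesis"
    then obtain r where r: "ereal (snd l) < r" "r < f (fst l)" using dense by (metis not_le)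
    have "eventually (\<lambda>z. r < f z) (nhds (fst l))"
      using assms r(2) by (auto simp: lower_semicontinuous_def)
    then have "eventually (\<lambda>n. r < f (fst (s n))) sequentially"
      by (rule eventually_compose_filterlim) (rule tendsto_fst[OF l])
    moreover have "(\<lambda>n. ereal (snd (s n))) \<longlonglongrightarrow> ereal (snd l)"
      by (intro tendsto_intros l)
    then have "eventually (\<lambda>n. ereal (snd (s n)) < r) sequentially"
      using r(1) by (rule order_tendstoD)
    ultimately have "eventually (\<lambda>n. False) sequentially"
    proof eventually_elim
      case (elim n)
      have "f (fst (s n)) \<le> ereal (snd (s n))" using s[rule_format, of n] by (auto simp: epi_def)
      then show False using elim by auto
    qed
    then show False by simp
  qed
  then show "l \<in> epi UNIV f" by (cases l) (simp add: epi_def)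
qed

section \<open>Polarizations\<close>

lemma iter_pol_mem:
  assumes "\<And>u H. u \<in> S \<Longrightarrow> pol u H \<in> S" "u \<in> S"
  shows "iter_pol pol Hs m u \<in> S"
  by (induction m) (simp_all add: assms)

lemma iter_pol_nonexpansive:
  assumes "\<And>u H. u \<in> S \<Longrightarrow> pol u H \<in> S" "polarizations_contract S pol i" "u \<in> S" "v \<in> S"
  shows "norm (i (iter_pol pol Hs m u) - i (iter_pol pol Hs m v)) \<le> norm (i u - i v)"
proof (induction m)
  case (Suc m)
  have "iter_pol pol Hs m u \<in> S" "iter_pol pol Hs m v \<in> S"
    using assms by (simp_all add: iter_pol_mem)
  then have "norm (i (iter_pol pol Hs (Suc m) u) - i (iter_pol pol Hs (Suc m) v))
      \<le> norm (i (iter_pol pol Hs m u) - i (iter_pol pol Hs m v))"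
    using assms(2) by (simp add: polarizations_contract_def)
  then show ?case using Suc by (rule order_trans)
qed simp

text \<open>One sequence of polarizers serves all of \<open>S\<close>, so both symmetrizations are
  limits of the same nonexpansive iterates.\<close>

lemma star_nonexpansive:
  assumes "\<And>u H. u \<in> S \<Longrightarrow> pol u H \<in> S" "polarizations_approximate S star pol i"
    "polarizations_contract S pol i" "u \<in> S" "v \<in> S"
  shows "norm (i (star u) - i (star v)) \<le> norm (i u - i v)"
proof -
  obtain Hs where "\<And>u. u \<in> S \<Longrightarrow> (\<lambda>m. i (iter_pol pol Hs m u)) \<longlonglongrightarrow> i (star u)"
    using assms(2) by (auto simp: polarizations_approximate_def)
  then have "(\<lambda>m. norm (i (iter_pol pol Hs m u) - i (iter_pol pol Hs m v)))
      \<longlonglongrightarrow> norm (i (star u) - i (star v))"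
    using assms(4,5) by (intro tendsto_intros)
  then show ?thesis
    by (rule LIMSEQ_le_const2) (use iter_pol_nonexpansive[OF assms(1,3-)] in blast)
qed

text \<open>The embedding stays general: in \<open>V\<close> the estimate transfers almost symmetry
  between nearby points, in \<open>W\<close> it identifies the limit.\<close>

lemma extended_sym_lipschitz:
  assumes "\<And>u H. u \<in> S \<Longrightarrow> pol u H \<in> S" "polarizations_approximate S star pol i"
    "polarizations_contract S pol i" "\<And>u. \<Theta> u \<in> S" "lipschitz_wrt i \<Theta>"
  obtains L where "L \<ge> 0"
    "\<And>u v. norm (i (extended_sym star \<Theta> u) - i (extended_sym star \<Theta> v)) \<le> L * norm (i u - i v)"
proof -
  obtain L where L: "\<And>u v. norm (i (\<Theta> u) - i (\<Theta> v)) \<le> L * norm (i u - i v)"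
    using assms(5) by (auto simp: lipschitz_wrt_def)
  have "norm (i (extended_sym star \<Theta> u) - i (extended_sym star \<Theta> v)) \<le> \<bar>L\<bar> * norm (i u - i v)" for u v
  proof -
    have "norm (i (extended_sym star \<Theta> u) - i (extended_sym star \<Theta> v)) \<le> norm (i (\<Theta> u) - i (\<Theta> v))"
      unfolding extended_sym_def by (rule star_nonexpansive[OF assms(1-3) assms(4,4)])
    also have "\<dots> \<le> L * norm (i u - i v)" by (rule L)
    also have "\<dots> \<le> \<bar>L\<bar> * norm (i u - i v)" by (intro mult_right_mono) auto
    finally show ?thesis .
  qed
  then show ?thesis by (intro that[of "\<bar>L\<bar>"]) auto
qed

text \<open>Pointwise convergence of nonexpansive maps is uniform on compact sets. Compactness is
  taken in the domain of \<open>i\<close>, whose continuity carries it to the norm of the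
  target.\<close>

lemma polarizations_approximate_uniformly:
  assumes polS: "\<And>u H. u \<in> S \<Longrightarrow> pol u H \<in> S" and contract: "polarizations_contract S pol i"
    and appr: "\<And>u. u \<in> S \<Longrightarrow> (\<lambda>m. i (iter_pol pol Hs m u)) \<longlonglongrightarrow> i (star u)"
    and i: "bounded_linear i" and C: "compact C" "C \<subseteq> S" and e: "e > 0"
  shows "\<exists>m. \<forall>u\<in>C. norm (i (iter_pol pol Hs m u) - i (star u)) < e"
proof (rule ccontr)
  assume "\<not> ?thesis"
  then have "\<forall>m. \<exists>u\<in>C. e \<le> norm (i (iter_pol pol Hs m u) - i (star u))" by (meson not_le)
  then obtain v where v: "\<And>m. v m \<in> C" "\<And>m. e \<le> norm (i (iter_pol pol Hs m (v m)) - i (star (v m)))"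
    by metis
  obtain l r where l: "l \<in> C" "strict_mono (r :: nat \<Rightarrow> nat)" "(v \<circ> r) \<longlonglongrightarrow> l"
    using C(1) v(1) unfolding compact_def by metis
  have approx: "polarizations_approximate S star pol i"
    using appr by (auto simp: polarizations_approximate_def)
  have lS: "l \<in> S" and vS: "v m \<in> S" for m using C l v by auto
  have 1: "(\<lambda>n. norm (i (iter_pol pol Hs (r n) l) - i (star l))) \<longlonglongrightarrow> norm (i (star l) - i (star l))"
    using LIMSEQ_subseq_LIMSEQ[OF appr[OF lS] l(2)] by (intro tendsto_intros) (simp add: o_def)
  have 2: "(\<lambda>n. norm (i (v (r n)) - i l)) \<longlonglongrightarrow> norm (i l - i l)"
    using l(3) by (intro tendsto_intros bounded_linear.tendsto[OF i]) (simp add: o_def)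
  have "(\<lambda>n. norm (i (iter_pol pol Hs (r n) l) - i (star l)) + 2 * norm (i (v (r n)) - i l))
      \<longlonglongrightarrow> norm (i (star l) - i (star l)) + 2 * norm (i l - i l)"
    by (rule tendsto_add[OF 1 tendsto_mult_left[OF 2]])
  \<comment> \<open>The factor 2 counts the passage from \<open>v (r n)\<close> to \<open>l\<close>
    under the iterate and under the symmetrization.\<close>
  moreover have "e \<le> norm (i (iter_pol pol Hs (r n) l) - i (star l)) + 2 * norm (i (v (r n)) - i l)" for n
  proof -
    have 1: "norm (i (iter_pol pol Hs (r n) (v (r n))) - i (iter_pol pol Hs (r n) l)) \<le> norm (i (v (r n)) - i l)"
      by (rule iter_pol_nonexpansive[OF polS contract vS lS])
    have 2: "norm (i (star l) - i (star (v (r n)))) \<le> norm (i (v (r n)) - i l)"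
      using star_nonexpansive[OF polS approx contract vS lS, of "r n"] by (simp add: norm_minus_commute)
    show ?thesis
      using 1 2 v(2)[of "r n"]
        norm_triangle_ineq[of "i (iter_pol pol Hs (r n) (v (r n))) - i (iter_pol pol Hs (r n) l)"
          "i (iter_pol pol Hs (r n) l) - i (star (v (r n)))"]
        norm_triangle_ineq[of "i (iter_pol pol Hs (r n) l) - i (star l)" "i (star l) - i (star (v (r n)))"]
      by simp
  qed
  ultimately have "e \<le> norm (i (star l) - i (star l)) + 2 * norm (i l - i l)"
    by (intro LIMSEQ_le_const) auto
  then show False using e by simp
qed

text \<open>By induction, each further polarizer is reached along a path of polarizers. The homotopy
  starts at a polarization rather than at the identity because the image of a polarization is fixed
  by its polarizer.\<close>

lemma polarization_homotopy:
  fixes pol :: "'x::topological_space \<Rightarrow> 'h::topological_space \<Rightarrow> 'x" and f :: "'x \<Rightarrow> ereal"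
  assumes polS: "\<And>u H. u \<in> S \<Longrightarrow> pol u H \<in> S" and conn: "path_connected (UNIV :: 'h set)"
    and cont: "continuous_on (S \<times> UNIV) (\<lambda>(u, H). pol u H)"
    and idem: "\<And>u H. u \<in> S \<Longrightarrow> pol (pol u H) H = pol u H"
    and f: "\<And>u H. u \<in> S \<Longrightarrow> f (pol u H) \<le> f u"
  shows "homotopic_with_canon (\<lambda>q. \<forall>u\<in>S. f (q u) \<le> f u) S S
    (\<lambda>u. pol u H\<^sub>0) (\<lambda>u. iter_pol pol Hs m (pol u H\<^sub>0))"
proof (induction m)
  case 0
  have "continuous_on S (\<lambda>u. (\<lambda>(u, H). pol u H) (u, H\<^sub>0))"
    by (rule continuous_on_compose2[OF cont]) (auto intro!: continuous_intros)
  then show ?case using polS f by auto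
next
  case (Suc m)
  define q where "q = (\<lambda>u. iter_pol pol Hs m (pol u H\<^sub>0))"
  define H where "H = (case m of 0 \<Rightarrow> H\<^sub>0 | Suc n \<Rightarrow> Hs n)"
  have qS: "q u \<in> S" if "u \<in> S" for u
    unfolding q_def using that polS by (intro iter_pol_mem) auto
  have qf: "f (q u) \<le> f u" if "u \<in> S" for u
    using homotopic_with_imp_property[OF Suc.IH] that by (simp add: q_def)
  have q_cont: "continuous_on S q"
    using homotopic_with_imp_continuous[OF Suc.IH] by (simp add: q_def)
  have q_fix: "pol (q u) H = q u" if "u \<in> S" for u
  proof (cases m)
    case 0 then show ?thesis using idem that by (simp add: q_def H_def)
  next
    case (Suc n)
    have "iter_pol pol Hs n (pol u H\<^sub>0) \<in> S" using that polS by (intro iter_pol_mem) auto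
    then show ?thesis using idem Suc by (simp add: q_def H_def)
  qed
  \<comment> \<open>\<open>H\<close> is the last polarizer applied in \<open>q\<close>, so by idempotence \<open>pol \<cdot> (g t)\<close> starts at \<open>q\<close>.\<close>
  obtain g where g: "path g" "pathstart g = H" "pathfinish g = Hs m"
    using conn unfolding path_connected_def by blast
  \<comment> \<open>The property depends only on values on \<open>S\<close>, so agreement at the
    endpoints is needed only there, where \<open>q_fix\<close> applies.\<close>
  have "homotopic_with_canon (\<lambda>q. \<forall>u\<in>S. f (q u) \<le> f u) S S q (\<lambda>u. pol (q u) (Hs m))"
  proof (subst homotopic_with, force, intro exI conjI ballI)
    let ?h = "\<lambda>(t, u). pol (q u) (g t)"
    have "continuous_on ({0..1} \<times> S) (\<lambda>p. (\<lambda>(u, H). pol u H) (q (snd p), g (fst p)))"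
    proof (rule continuous_on_compose2[OF cont])
      show "continuous_on ({0..1} \<times> S) (\<lambda>p. (q (snd p), g (fst p)))"
        by (intro continuous_intros continuous_on_compose2[OF q_cont]
              continuous_on_compose2[OF g(1)[unfolded path_def]]) auto
    qed (use qS in auto)
    then have "continuous_on ({0..1} \<times> S) ?h" by (simp add: case_prod_unfold)
    then show "continuous_map (prod_topology (top_of_set {0..1}) (top_of_set S)) (top_of_set S) ?h"
      using qS polS by (auto simp: continuous_map_subtopology_eu)
    show "?h (0, u) = q u" if "u \<in> topspace (top_of_set S)" for u
      using g q_fix that by (simp add: pathstart_def)
    show "?h (1, u) = pol (q u) (Hs m)" for u
      using g by (simp add: pathfinish_def)
    show "f (?h (t, u)) \<le> f u" if "u \<in> S" for t u
      using f[OF qS[OF that]] qf[OF that] by (auto intro: order_trans)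
  qed
  with Suc.IH show ?case unfolding q_def iter_pol.simps by (rule homotopic_with_trans)
qed

text \<open>Closeness to the symmetrization is claimed only above height \<open>a\<close>. This
  leaves room at height \<open>a\<close> to pass from the almost symmetric map to the single
  polarization prescribed on the sphere.\<close>

lemma almost_symmetric_lift:
  fixes S :: "'x::banach set" and pol :: "'x \<Rightarrow> 'h::topological_space \<Rightarrow> 'x" and f :: "'x \<Rightarrow> ereal"
    and \<gamma> :: "'p::euclidean_space \<Rightarrow> 'x"
  assumes framework: "symmetrization_framework S star pol \<Theta> i"
    and f: "\<And>u H. u \<in> S \<Longrightarrow> f (pol u H) \<le> f u"
    and \<gamma>: "continuous_on (cball 0 1) \<gamma>" "\<gamma> ` cball 0 1 \<subseteq> S"
      "\<And>\<tau>. \<tau> \<in> cball 0 1 \<Longrightarrow> f (\<gamma> \<tau>) \<le> ereal M" "\<And>\<tau>. \<tau> \<in> sphere 0 1 \<Longrightarrow> f (\<gamma> \<tau>) \<le> ereal a"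
    and aM: "a \<le> M" and e: "e > 0"
  obtains k :: "'p \<Rightarrow> 'x \<times> real" where "continuous_on UNIV k" "bounded (range k)"
    "\<And>x. k x \<in> epi UNIV f" "\<And>x. snd (k x) \<le> M" "\<And>x. norm x \<ge> 1 \<Longrightarrow> snd (k x) = a"
    "\<And>x. norm x = 1 \<Longrightarrow> fst (k x) = pol (\<gamma> x) H\<^sub>0"
    "\<And>x. a < snd (k x) \<Longrightarrow> norm (i (fst (k x)) - i (extended_sym star \<Theta> (fst (k x)))) < e"
proof -
  have polS: "\<And>u H. u \<in> S \<Longrightarrow> pol u H \<in> S" and conn: "path_connected (UNIV :: 'h set)"
    and i: "bounded_linear i" and cont: "continuous_on (S \<times> UNIV) (\<lambda>(u, H). pol u H)"
    and idem: "\<And>u H. u \<in> S \<Longrightarrow> pol (pol u H) H = pol u H"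
    and star_pol: "\<And>u H. u \<in> S \<Longrightarrow> star (pol u H) = star u"
    and appr: "polarizations_approximate S star pol i" and contr: "polarizations_contract S pol i"
    and \<Theta>: "\<And>u. u \<in> S \<Longrightarrow> \<Theta> u = u"
    using framework by (auto simp: symmetrization_framework_def continuous_embedding_def)
  obtain Hs where Hs: "\<And>u. u \<in> S \<Longrightarrow> (\<lambda>m. i (iter_pol pol Hs m u)) \<longlonglongrightarrow> i (star u)"
    using appr by (auto simp: polarizations_approximate_def)
  have iterS: "iter_pol pol Hs m u \<in> S" if "u \<in> S" for u m
    by (rule iter_pol_mem[OF polS that])
  have star_iter: "star (iter_pol pol Hs m u) = star u" if "u \<in> S" for u m
    by (induction m) (simp_all add: star_pol iterS that)
  define C where "C = (\<lambda>\<tau>. pol (\<gamma> \<tau>) H\<^sub>0) ` cball 0 1"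
  have "continuous_on (cball 0 1) (\<lambda>\<tau>. (\<lambda>(u, H). pol u H) (\<gamma> \<tau>, H\<^sub>0))"
    by (rule continuous_on_compose2[OF cont]) (use \<gamma> in \<open>auto intro!: continuous_intros\<close>)
  then have "compact C" unfolding C_def by (intro compact_continuous_image) auto
  moreover have CS: "C \<subseteq> S" unfolding C_def using \<gamma>(2) polS by auto
  ultimately obtain m where m: "\<And>u. u \<in> C \<Longrightarrow> norm (i (iter_pol pol Hs m u) - i (star u)) < e"
    using polarizations_approximate_uniformly[OF polS contr Hs i _ _ e] by metis
  have "homotopic_with_canon (\<lambda>q. \<forall>u\<in>S. f (q u) \<le> f u) S S
    (\<lambda>u. pol u H\<^sub>0) (\<lambda>u. iter_pol pol Hs m (pol u H\<^sub>0))"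
    by (rule polarization_homotopy[where f = f and pol = pol and S = S]) (fact polS conn cont idem f)+
  then obtain Q where Q_cont: "continuous_on ({0..1::real} \<times> S) Q"
    and Q: "\<And>u. Q (0, u) = pol u H\<^sub>0" "\<And>u. Q (1, u) = iter_pol pol Hs m (pol u H\<^sub>0)"
      "\<And>t u. t \<in> {0..1} \<Longrightarrow> u \<in> S \<Longrightarrow> f (Q (t, u)) \<le> f u"
    unfolding homotopic_with_def by (auto simp: continuous_map_subtopology_eu)
  \<comment> \<open>On \<open>1/3 \<le> |x| \<le> 2/3\<close> the height falls from \<open>M\<close> to \<open>a\<close>; on \<open>2/3 \<le> |x| \<le> 1\<close>, at height \<open>a\<close>, the
    homotopy \<open>Q\<close> is run back to its start.\<close>
  define y where "y x = (3 / max 1 (3 * norm x)) *\<^sub>R x" for x :: 'p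
  define s where "s x = max 0 (min 1 (3 * norm x - 1))" for x :: 'p
  define t where "t x = max 0 (min 1 (3 - 3 * norm x))" for x :: 'p
  define k where "k x = (Q (t x, \<gamma> (y x)), M + s x * (a - M))" for x
  have y_ball: "y x \<in> cball 0 1" for x by (auto simp: y_def max_def)
  have y_sphere: "y x \<in> sphere 0 1" if "1 \<le> 3 * norm x" for x using that by (auto simp: y_def max_def)
  have yS: "\<gamma> (y x) \<in> S" for x using y_ball \<gamma>(2) by blast
  have s01: "s x \<in> {0..1}" and t01: "t x \<in> {0..1}" for x by (auto simp: s_def t_def)
  have k2: "snd (k x) \<in> {a..M}" for x
  proof -
    have "s x * (a - M) \<le> 0" "1 * (a - M) \<le> s x * (a - M)"
      using s01[of x] aM mult_right_mono_neg[of "s x" 1 "a - M"] mult_nonneg_nonpos[of "s x" "a - M"] by auto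
    then show ?thesis by (simp add: k_def)
  qed
  have y_cont: "continuous_on UNIV y" unfolding y_def by (intro continuous_intros) auto
  have \<gamma>y_cont: "continuous_on UNIV (\<lambda>x. \<gamma> (y x))"
    by (rule continuous_on_compose2[OF \<gamma>(1) y_cont]) (use y_ball in blast)
  have "continuous_on UNIV t" unfolding t_def by (intro continuous_intros)
  then have "continuous_on UNIV (\<lambda>x. Q (t x, \<gamma> (y x)))"
    by (intro continuous_on_compose2[OF Q_cont] continuous_on_Pair \<gamma>y_cont) (use t01 yS in auto)
  then have k_cont: "continuous_on UNIV k"
    unfolding k_def s_def by (intro continuous_intros)
  have "compact (Q ` ({0..1} \<times> \<gamma> ` cball 0 1) \<times> {a..M})"
    using \<gamma>(1,2) Q_cont
    by (intro compact_Times compact_continuous_image) (auto intro: continuous_on_subset)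
  moreover have "range k \<subseteq> Q ` ({0..1} \<times> \<gamma> ` cball 0 1) \<times> {a..M}"
  proof
    fix p assume "p \<in> range k"
    then obtain x where x: "p = k x" by blast
    have "(t x, \<gamma> (y x)) \<in> {0..1} \<times> \<gamma> ` cball 0 1" using t01 y_ball by blast
    then have "fst p \<in> Q ` ({0..1} \<times> \<gamma> ` cball 0 1)" by (simp add: x k_def)
    then show "p \<in> Q ` ({0..1} \<times> \<gamma> ` cball 0 1) \<times> {a..M}" using k2[of x] x by (simp add: mem_Times_iff)
  qed
  ultimately have k_bounded: "bounded (range k)" by (meson bounded_subset compact_imp_bounded)
  have "f (fst (k x)) \<le> ereal (snd (k x))" for x
  proof -
    have *: "f (fst (k x)) \<le> f (\<gamma> (y x))" using Q(3)[OF t01 yS] by (simp add: k_def)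
    show ?thesis
    \<comment> \<open>On the collars \<open>y x\<close> lies on the sphere, where \<open>f\<close>
      is at most \<open>a\<close>, so any height from \<open>a\<close> to \<open>M\<close> is
      admissible; inside them the height is \<open>M\<close>.\<close>
    proof (cases "1 \<le> 3 * norm x")
      case True
      have "f (\<gamma> (y x)) \<le> ereal a" by (rule \<gamma>(4)[OF y_sphere[OF True]])
      also have "\<dots> \<le> ereal (snd (k x))" using k2[of x] by simp
      finally show ?thesis using * by (rule order_trans[rotated])
    next
      case False
      then have "snd (k x) = M" by (simp add: k_def s_def)
      then show ?thesis using * \<gamma>(3)[OF y_ball, of x] by (auto intro: order_trans)
    qed
  qed
  then have k_epi: "k x \<in> epi UNIV f" for x by (auto simp: epi_def case_prod_unfold)
  have near: "norm (i (fst (k x)) - i (extended_sym star \<Theta> (fst (k x)))) < e" if "a < snd (k x)" for x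
  proof -
    \<comment> \<open>Inside radius 2/3 the homotopy sits at its end, the full chain of
      polarizations.\<close>
    have "3 * norm x < 2"
    proof (rule ccontr)
      assume "\<not> ?thesis"
      then have "s x = 1" by (simp add: s_def)
      then show False using that by (simp add: k_def)
    qed
    then have "t x = 1" by (simp add: t_def)
    define u where "u = pol (\<gamma> (y x)) H\<^sub>0"
    have u: "u \<in> C" "u \<in> S" using y_ball[of x] polS yS by (auto simp: u_def C_def)
    have k_u: "fst (k x) = iter_pol pol Hs m u" using \<open>t x = 1\<close> by (simp add: k_def Q(2) u_def)
    \<comment> \<open>Polarizations leave the symmetrization unchanged, so comparison with
      \<open>star u\<close> is the required one.\<close>
    have "extended_sym star \<Theta> (fst (k x)) = star u"
      using u by (simp add: k_u extended_sym_def \<Theta> iterS star_iter)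
    then show ?thesis using m[OF u(1)] by (simp add: k_u)
  qed
  show ?thesis
  proof (rule that[OF k_cont k_bounded k_epi _ _ _ near])
    show "snd (k x) \<le> M" for x using k2[of x] by simp
    show "snd (k x) = a" if "norm x \<ge> 1" for x using that by (simp add: k_def s_def)
    show "fst (k x) = pol (\<gamma> x) H\<^sub>0" if "norm x = 1" for x
      using that by (simp add: k_def t_def y_def Q(1))
  qed
qed

section \<open>Almost symmetric Palais-Smale sequences and their limits\<close>

theorem theorem5p1:
  fixes S :: "'x::banach set"
    and star :: "'x \<Rightarrow> 'x"
    and pol :: "'x \<Rightarrow> 'h::topological_space \<Rightarrow> 'x"
    and \<Theta> :: "'x \<Rightarrow> 'x"
    and iV :: "'x \<Rightarrow> 'v::banach"
    and jW :: "'v \<Rightarrow> 'w::banach"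
    and f :: "'x \<Rightarrow> ereal"
    and \<Gamma>\<^sub>0 \<Gamma> :: "(real ^ 'm \<Rightarrow> 'x) set"
    and c a :: ereal
  assumes reflexive: "reflexive_banach TYPE('x)"
    and framework: "symmetrization_framework S star pol \<Theta> iV"
    and a_inj: "continuous_embedding iV" "continuous_embedding jW"
    and f_range: "\<And>u. f u \<noteq> -\<infinity>"
    and f_lsc: "lower_semicontinuous f"
    and f_epi: "\<And>u \<xi>. (u, \<xi>) \<in> epi UNIV f \<Longrightarrow> f u < ereal \<xi> \<Longrightarrow>
                  weak_slope (epi UNIV f) epi_height (u, \<xi>) = 1"
    and \<Gamma>\<^sub>0: "\<Gamma>\<^sub>0 \<subseteq> cmaps (sphere 0 1)"
    and \<Gamma>_def: "\<Gamma> = {\<gamma> \<in> cmaps (cball 0 1). restrict \<gamma> (sphere 0 1) \<in> \<Gamma>\<^sub>0}"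
    and c_def: "c = (INF \<gamma>\<in>\<Gamma>. SUP \<tau>\<in>cball 0 1. f (\<gamma> \<tau>))"
    and a_def: "a = (SUP \<gamma>\<^sub>0\<in>\<Gamma>\<^sub>0. SUP \<tau>\<in>sphere 0 1. f (\<gamma>\<^sub>0 \<tau>))"
    and c_a: "c < \<infinity>" "a < c"
    and b: "\<And>H u. u \<in> S \<Longrightarrow> f (pol u H) \<le> f u"
    and c: "\<And>\<gamma>. \<gamma> \<in> \<Gamma> \<Longrightarrow> \<exists>\<gamma>'\<in>\<Gamma>. \<exists>H\<^sub>0.
              \<gamma>' ` cball 0 1 \<subseteq> S \<and> (\<forall>\<tau>\<in>cball 0 1. f (\<gamma>' \<tau>) \<le> f (\<gamma> \<tau>)) \<and>
              restrict (\<lambda>\<tau>. pol (\<gamma>' \<tau>) H\<^sub>0) (sphere 0 1) \<in> \<Gamma>\<^sub>0"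
    and d: "\<And>us. palais_smale f us \<Longrightarrow> bounded (range us)"
    and e: "\<And>us. palais_smale f us \<Longrightarrow> convergent (\<lambda>h. jW (iV (extended_sym star \<Theta> (us h))))"
  shows "\<exists>u us. palais_smale_at f c us \<and>
           weakly_converges us u \<and>
           (\<lambda>h. jW (iV (us h))) \<longlonglongrightarrow> jW (iV u) \<and>
           (polarizations_approximate S star pol (jW \<circ> iV) \<and>
            polarizations_contract S pol (jW \<circ> iV) \<and>
            lipschitz_wrt (jW \<circ> iV) \<Theta>
            \<longrightarrow> jW (iV u) = jW (iV (extended_sym star \<Theta> u)))"
proof -
  have polS: "\<And>u H. u \<in> S \<Longrightarrow> pol u H \<in> S"
    and appr: "polarizations_approximate S star pol iV" and contr: "polarizations_contract S pol iV"
    and \<Theta>S: "\<And>u. \<Theta> u \<in> S" and lip: "lipschitz_wrt iV \<Theta>"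
    using framework by (auto simp: symmetrization_framework_def)
  have iV: "bounded_linear iV" "inj iV" and jW: "bounded_linear jW" "inj jW"
    using a_inj by (auto simp: continuous_embedding_def)
  have \<Gamma>_sphere: "f (\<gamma> \<tau>) \<le> a" if "\<gamma> \<in> \<Gamma>" "\<tau> \<in> sphere 0 1" for \<gamma> \<tau>
  proof -
    have "f (restrict \<gamma> (sphere 0 1) \<tau>) \<le> (SUP \<tau>\<in>sphere 0 1. f (restrict \<gamma> (sphere 0 1) \<tau>))"
      by (rule SUP_upper) (rule that)
    also have "\<dots> \<le> a" unfolding a_def
      by (rule SUP_upper) (use that \<Gamma>_def in blast)
    finally show ?thesis using that by simp
  qed
  \<comment> \<open>An infimum over the empty set would be infinite. A value of some map on the
    sphere then keeps \<open>a\<close> above minus infinity, and \<open>a < c < \<infinity>\<close>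
    makes both levels real.\<close>
  have "\<Gamma> \<noteq> {}" using c_a(1) by (auto simp: c_def top_ereal_def)
  then obtain \<gamma>1 where "\<gamma>1 \<in> \<Gamma>" by blast
  moreover obtain \<tau>1 :: "real ^ 'm" where "\<tau>1 \<in> sphere 0 1" using vector_choose_size[of 1] by auto
  ultimately have "a \<noteq> -\<infinity>" using \<Gamma>_sphere f_range by fastforce
  with c_a have "\<bar>a\<bar> \<noteq> \<infinity>" "\<bar>c\<bar> \<noteq> \<infinity>" by auto
  then obtain a' c' where a': "a = ereal a'" and c': "c = ereal c'" by (metis ereal_real')
  have ac: "a' < c'" using c_a a' c' by simp
  obtain L where L: "L \<ge> 0"
    "\<And>u v. norm (iV (extended_sym star \<Theta> u) - iV (extended_sym star \<Theta> v)) \<le> L * norm (iV u - iV v)"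
    using extended_sym_lipschitz[OF polS appr contr \<Theta>S lip] by blast
  obtain B where B: "B > 0" "\<And>x. norm (iV x) \<le> norm x * B"
    using bounded_linear.pos_bounded[OF iV(1)] by blast
  have approx: "\<exists>u. \<bar>f u\<bar> \<noteq> \<infinity> \<and> ereal (c' - \<epsilon>) \<le> f u \<and> f u \<le> ereal (c' + \<epsilon>) \<and>
      weak_slope UNIV f u \<le> ereal \<epsilon> \<and> norm (iV u - iV (extended_sym star \<Theta> u)) \<le> \<epsilon>"
    if \<epsilon>: "\<epsilon> > 0" for \<epsilon>
  proof -
    \<comment> \<open>Passing from an almost symmetric \<open>v\<close> to \<open>u\<close> at
      distance \<open>e\<close> costs \<open>B * e\<close> for the embedding and
      \<open>L * (B * e)\<close> for the symmetrization; with the gap \<open>e\<close> of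
      \<open>v\<close> the total is \<open>e * N\<close>.\<close>
    define N where "N = B + 1 + L * B"
    have N: "N > 0" using B(1) L(1) by (simp add: N_def add_pos_nonneg)
    \<comment> \<open>The bounds serve, in order, for \<open>2 * e < 1\<close> and
      \<open>4 * e \<le> 1\<close> in the slope estimates, for the final slope \<open>4 * e\<close>,
      for staying above \<open>a'\<close>, and for the gap \<open>e * N\<close>.\<close>
    define e where "e = min (min (1/4) (\<epsilon> / 4)) (min ((c' - a') / 4) (\<epsilon> / N))"
    have "e > 0" unfolding e_def using \<epsilon> ac N by auto
    have e: "e \<le> 1/4" "e \<le> \<epsilon> / 4" "e \<le> (c' - a') / 4" "e \<le> \<epsilon> / N"
      unfolding e_def by linarith+
    have e2: "e\<^sup>2 \<le> e" using \<open>e > 0\<close> e(1) by (simp add: power2_eq_square mult_left_le)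
    have "c < ereal (c' + e\<^sup>2)" using c' \<open>e > 0\<close> by simp
    then obtain \<gamma> where \<gamma>: "\<gamma> \<in> \<Gamma>" "(SUP \<tau>\<in>cball 0 1. f (\<gamma> \<tau>)) < ereal (c' + e\<^sup>2)"
      unfolding c_def INF_less_iff by blast
    obtain \<gamma>' H\<^sub>0 where \<gamma>': "\<gamma>' \<in> \<Gamma>" "\<gamma>' ` cball 0 1 \<subseteq> S" "\<And>\<tau>. \<tau> \<in> cball 0 1 \<Longrightarrow> f (\<gamma>' \<tau>) \<le> f (\<gamma> \<tau>)"
        "restrict (\<lambda>\<tau>. pol (\<gamma>' \<tau>) H\<^sub>0) (sphere 0 1) \<in> \<Gamma>\<^sub>0"
      using c[OF \<gamma>(1)] by blast
    have \<gamma>'M: "f (\<gamma>' \<tau>) \<le> ereal (c' + e\<^sup>2)" if "\<tau> \<in> cball 0 1" for \<tau>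
      using \<gamma>'(3)[OF that] SUP_upper[OF that, of "\<lambda>\<tau>. f (\<gamma> \<tau>)"] \<gamma>(2) by simp
    have \<gamma>'a: "f (\<gamma>' \<tau>) \<le> ereal a'" if "\<tau> \<in> sphere 0 1" for \<tau>
      using \<Gamma>_sphere[OF \<gamma>'(1) that] a' by simp
    have "continuous_on (cball 0 1) \<gamma>'" using \<gamma>'(1) by (simp add: \<Gamma>_def cmaps_def)
    moreover have "a' \<le> c' + e\<^sup>2" using ac by (simp add: add_increasing2)
    ultimately obtain k :: "real ^ 'm \<Rightarrow> 'x \<times> real" where k: "continuous_on UNIV k" "bounded (range k)"
      "\<And>x. k x \<in> epi UNIV f" "\<And>x. snd (k x) \<le> c' + e\<^sup>2" "\<And>x. norm x \<ge> 1 \<Longrightarrow> snd (k x) = a'"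
      "\<And>x. norm x = 1 \<Longrightarrow> fst (k x) = pol (\<gamma>' x) H\<^sub>0"
      "\<And>x. a' < snd (k x) \<Longrightarrow> norm (iV (fst (k x)) - iV (extended_sym star \<Theta> (fst (k x)))) < e"
      using almost_symmetric_lift[OF framework b _ \<gamma>'(2) \<gamma>'M \<gamma>'a _ \<open>e > 0\<close>] by blast
    \<comment> \<open>The horizontal part of a competitor has the boundary trace provided by
      condition (c), so it belongs to \<open>\<Gamma>\<close>; as \<open>f\<close> lies below the
      height, the largest height is at least \<open>c\<close>.\<close>
    have low: "\<exists>x\<in>cball 0 1. c' \<le> snd (g x)"
      if g: "continuous_on UNIV g" "\<And>x. g x \<in> epi UNIV f" "\<And>x. norm x \<ge> 1 \<Longrightarrow> g x = k x" for g
    proof -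
      define \<beta> where "\<beta> = restrict (\<lambda>x. fst (g x)) (cball 0 1)"
      have "restrict \<beta> (sphere 0 1) = restrict (\<lambda>\<tau>. pol (\<gamma>' \<tau>) H\<^sub>0) (sphere 0 1)"
        using g(3) k(6) by (auto simp: \<beta>_def restrict_def fun_eq_iff)
      moreover have "continuous_on (cball 0 1) (\<lambda>x. fst (g x))"
        by (intro continuous_intros continuous_on_subset[OF g(1)]) simp
      then have "\<beta> \<in> cmaps (cball 0 1)"
        by (auto simp: cmaps_def \<beta>_def intro: continuous_on_eq)
      ultimately have "\<beta> \<in> \<Gamma>" using \<gamma>'(4) by (simp add: \<Gamma>_def)
      have "continuous_on (cball 0 1) (\<lambda>x. snd (g x))"
        by (intro continuous_intros continuous_on_subset[OF g(1)]) simp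
      then obtain x where x: "x \<in> cball 0 1" "\<And>z. z \<in> cball 0 1 \<Longrightarrow> snd (g z) \<le> snd (g x)"
        using continuous_attains_sup[of "cball 0 1"] by (metis compact_cball cball_eq_empty not_one_less_zero)
      have "c \<le> (SUP \<tau>\<in>cball 0 1. f (\<beta> \<tau>))" unfolding c_def by (rule INF_lower) fact
      also have "\<dots> \<le> ereal (snd (g x))"
      proof (rule SUP_least)
        fix \<tau> :: "real ^ 'm" assume \<tau>: "\<tau> \<in> cball 0 1"
        have "f (fst (g \<tau>)) \<le> ereal (snd (g \<tau>))" using g(2)[of \<tau>] by (auto simp: epi_def)
        then show "f (\<beta> \<tau>) \<le> ereal (snd (g x))"
          using x(2)[OF \<tau>] \<tau> by (auto simp: \<beta>_def intro: order_trans)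
      qed
      finally show ?thesis using x(1) c' by auto
    qed
    have k': "apply_bcontfun (Bcontfun k) = k" using k(1,2) by (simp add: Bcontfun_inverse bcontfun_def)
    have "closed (epi UNIV f)" "continuous_on UNIV (snd :: 'x \<times> real \<Rightarrow> real)"
      by (auto intro: closed_epi f_lsc continuous_intros)
    moreover have "snd (k x) < c' - e" if "norm x \<ge> 1" for x
      using k(5)[OF that] e(3) ac by simp
    ultimately obtain x y where y: "y \<in> epi UNIV f" "dist y (k x) \<le> e" "c' - e \<le> snd y"
      "snd y \<le> c' + e\<^sup>2" "\<not> descends (epi UNIV f) snd (2 * e) y"
      using almost_critical_point_near_minimax_map[of "epi UNIV f" snd e e "Bcontfun k" c', unfolded k']
        \<open>e > 0\<close> k(3,4) low by metis
    obtain u \<xi> where [simp]: "y = (u, \<xi>)" by (cases y)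
    \<comment> \<open>Strictly above the graph the height has slope 1, more than
      \<open>2 * e\<close>, so the almost critical point lies on the graph.\<close>
    have fu: "f u = ereal \<xi>"
    proof (rule ccontr)
      assume "f u \<noteq> ereal \<xi>"
      then have "f u < ereal \<xi>" using y(1) by (auto simp: epi_def)
      then have "weak_slope (epi UNIV f) epi_height (u, \<xi>) = 1" using f_epi y(1) by simp
      moreover have "ereal (2 * e) < 1" using e(1) by (simp add: one_ereal_def)
      ultimately show False using y(5) descends_epi_above_graph[of "2 * e" f u \<xi>] by simp
    qed
    have slope: "weak_slope UNIV f u \<le> ereal (4 * e)"
    proof (rule ccontr)
      assume "\<not> ?thesis"
      then have "descends (epi UNIV f) snd (4 * e / sqrt (1 + (4 * e)\<^sup>2)) y"
        using descends_epi_on_graph[of "4 * e" f u] \<open>e > 0\<close> by (simp add: fu not_le)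
      \<comment> \<open>Since \<open>4 * e \<le> 1\<close>, the normalizing root is at most 2 and
        half the rate survives.\<close>
      moreover have "2 * e \<le> 4 * e / sqrt (1 + (4 * e)\<^sup>2)"
      proof -
        have "(4 * e)\<^sup>2 \<le> 1\<^sup>2" using \<open>e > 0\<close> e(1) by (intro power_mono) auto
        then have "sqrt (1 + (4 * e)\<^sup>2) \<le> 2" by (intro real_le_lsqrt) auto
        moreover have "sqrt (1 + (4 * e)\<^sup>2) > 0" by (simp add: add_pos_nonneg)
        ultimately show ?thesis using \<open>e > 0\<close> by (simp add: field_simps)
      qed
      ultimately show False using y(5) descends_mono by blast
    qed
    define v where "v = fst (k x)"
    have "dist u v \<le> e" "dist \<xi> (snd (k x)) \<le> e"
      using y(2) dist_fst_le[of y "k x"] dist_snd_le[of y "k x"] by (auto simp: v_def)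
    \<comment> \<open>The height of \<open>k x\<close> is at least \<open>c' - 2 * e\<close>, which
      is above \<open>a'\<close>; there the lift is almost symmetric.\<close>
    then have "a' < snd (k x)" using y(3) e(3) ac by (auto simp: dist_real_def)
    from k(7)[OF this] have v: "norm (iV v - iV (extended_sym star \<Theta> v)) < e" by (simp add: v_def)
    have uv: "norm (iV u - iV v) \<le> B * e"
    proof -
      have "norm (iV u - iV v) \<le> norm (u - v) * B"
        using B(2)[of "u - v"] by (simp add: linear_diff bounded_linear.linear[OF iV(1)])
      also have "\<dots> \<le> e * B" using \<open>dist u v \<le> e\<close> B(1) by (intro mult_right_mono) (auto simp: dist_norm)
      finally show ?thesis by (simp add: mult.commute)
    qed
    have "norm (iV (extended_sym star \<Theta> v) - iV (extended_sym star \<Theta> u)) \<le> L * (B * e)"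
      using L(2)[of v u] mult_left_mono[OF uv L(1)] by (simp add: norm_minus_commute)
    then have "norm (iV u - iV (extended_sym star \<Theta> u)) \<le> B * e + e + L * (B * e)"
      using uv v norm_triangle_ineq[of "iV u - iV v" "iV v - iV (extended_sym star \<Theta> v)"]
        norm_triangle_ineq[of "iV u - iV (extended_sym star \<Theta> v)"
          "iV (extended_sym star \<Theta> v) - iV (extended_sym star \<Theta> u)"] by simp
    also have "\<dots> = e * N" by (simp add: N_def algebra_simps)
    also have "\<dots> \<le> \<epsilon>" using e(4) N by (simp add: field_simps)
    finally have "norm (iV u - iV (extended_sym star \<Theta> u)) \<le> \<epsilon>" .
    moreover have "weak_slope UNIV f u \<le> ereal \<epsilon>"
      by (rule order_trans[OF slope]) (use e(2) in simp)
    ultimately show ?thesis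
      using y(3,4) e2 e(2) \<open>e > 0\<close> by (intro exI[of _ u]) (simp add: fu)
  qed
  have "\<exists>us. \<forall>n. \<bar>f (us n)\<bar> \<noteq> \<infinity> \<and> ereal (c' - inverse (real (Suc n))) \<le> f (us n) \<and>
      f (us n) \<le> ereal (c' + inverse (real (Suc n))) \<and> weak_slope UNIV f (us n) \<le> ereal (inverse (real (Suc n))) \<and>
      norm (iV (us n) - iV (extended_sym star \<Theta> (us n))) \<le> inverse (real (Suc n))"
    by (intro choice allI approx) simp
  then obtain us where all: "\<forall>n. \<bar>f (us n)\<bar> \<noteq> \<infinity> \<and> ereal (c' - inverse (real (Suc n))) \<le> f (us n) \<and>
      f (us n) \<le> ereal (c' + inverse (real (Suc n))) \<and> weak_slope UNIV f (us n) \<le> ereal (inverse (real (Suc n))) \<and>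
      norm (iV (us n) - iV (extended_sym star \<Theta> (us n))) \<le> inverse (real (Suc n))"
    by (rule exE)
  note us = all[THEN spec, THEN conjunct1]
    all[THEN spec, THEN conjunct2, THEN conjunct1]
    all[THEN spec, THEN conjunct2, THEN conjunct2, THEN conjunct1]
    all[THEN spec, THEN conjunct2, THEN conjunct2, THEN conjunct2, THEN conjunct1]
    all[THEN spec, THEN conjunct2, THEN conjunct2, THEN conjunct2, THEN conjunct2]
  note inv = LIMSEQ_inverse_real_of_nat
  have ps: "palais_smale_at f c us"
  proof -
    have "(\<lambda>n. ereal (c' - inverse (real (Suc n)))) \<longlonglongrightarrow> ereal (c' - 0)"
      by (intro tendsto_intros inv)
    moreover have "(\<lambda>n. ereal (c' + inverse (real (Suc n)))) \<longlonglongrightarrow> ereal (c' + 0)"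
      by (intro tendsto_intros inv)
    ultimately have "(\<lambda>n. f (us n)) \<longlonglongrightarrow> ereal c'"
      using tendsto_sandwich[OF always_eventually[OF allI[OF us(2)]] always_eventually[OF allI[OF us(3)]]]
      by (simp only: diff_zero add_0_right)
    moreover have "(\<lambda>n. ereal (inverse (real (Suc n)))) \<longlonglongrightarrow> ereal 0"
      by (intro tendsto_intros inv)
    then have "(\<lambda>n. weak_slope UNIV f (us n)) \<longlonglongrightarrow> 0"
      using tendsto_sandwich[OF always_eventually[OF allI[OF weak_slope_nonneg]]
          always_eventually[OF allI[OF us(4)]] tendsto_const]
      by (simp only: zero_ereal_def)
    ultimately show ?thesis using us(1) c' by (simp add: palais_smale_at_def)
  qed
  then have PS: "palais_smale f us" by (auto simp: palais_smale_def)
  obtain w where w: "(\<lambda>h. jW (iV (extended_sym star \<Theta> (us h)))) \<longlonglongrightarrow> w"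
    using e[OF PS] by (auto simp: convergent_def)
  \<comment> \<open>The gap to the symmetrized sequence vanishes in \<open>V\<close>, hence in
    \<open>W\<close>, so convergence in \<open>W\<close> passes to \<open>us\<close> itself.\<close>
  have "(\<lambda>n. iV (us n) - iV (extended_sym star \<Theta> (us n))) \<longlonglongrightarrow> 0"
    by (rule Lim_null_comparison[OF _ inv]) (use us(5) in simp)
  then have "(\<lambda>n. jW (iV (us n) - iV (extended_sym star \<Theta> (us n)))) \<longlonglongrightarrow> jW 0"
    by (rule bounded_linear.tendsto[OF jW(1)])
  then have gap: "(\<lambda>n. jW (iV (us n)) - jW (iV (extended_sym star \<Theta> (us n)))) \<longlonglongrightarrow> 0"
    using bounded_linear.linear[OF jW(1)] by (simp add: linear_diff linear_0)
  have lim: "(\<lambda>n. jW (iV (us n))) \<longlonglongrightarrow> w" using tendsto_add[OF gap w] by simp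
  have "bounded_linear (\<lambda>x. jW (iV x))" "inj (\<lambda>x. jW (iV x))"
    using bounded_linear_compose[OF jW(1) iV(1)] inj_compose[OF jW(2) iV(2)] by (auto simp: o_def)
  then obtain u where u: "jW (iV u) = w" "weakly_converges us u"
    using weak_limit_of_strong_limit_in_superspace[OF reflexive d[OF PS] _ _ lim] by blast
  \<comment> \<open>The extended symmetrization is now Lipschitz for the norm of \<open>W\<close>,
    so the symmetrized sequence tends to the symmetrization of \<open>u\<close> as well as to
    \<open>w\<close>.\<close>
  have "jW (iV u) = jW (iV (extended_sym star \<Theta> u))"
    if W: "polarizations_approximate S star pol (jW \<circ> iV)" "polarizations_contract S pol (jW \<circ> iV)"
      "lipschitz_wrt (jW \<circ> iV) \<Theta>"
  proof -
    obtain K where K: "\<And>u v. norm ((jW \<circ> iV) (extended_sym star \<Theta> u) - (jW \<circ> iV) (extended_sym star \<Theta> v))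
        \<le> K * norm ((jW \<circ> iV) u - (jW \<circ> iV) v)"
      using extended_sym_lipschitz[OF polS W(1,2) \<Theta>S W(3)] by blast
    have bound: "norm (jW (iV (extended_sym star \<Theta> (us n))) - jW (iV (extended_sym star \<Theta> u)))
        \<le> K * norm (jW (iV (us n)) - jW (iV u))" for n
      using K[of "us n" u] by (simp only: o_def)
    have "(\<lambda>n. K * norm (jW (iV (us n)) - jW (iV u))) \<longlonglongrightarrow> K * norm (w - jW (iV u))"
      by (intro tendsto_intros lim)
    then have "(\<lambda>n. K * norm (jW (iV (us n)) - jW (iV u))) \<longlonglongrightarrow> 0" by (simp add: u(1))
    then have "(\<lambda>n. jW (iV (extended_sym star \<Theta> (us n))) - jW (iV (extended_sym star \<Theta> u))) \<longlonglongrightarrow> 0"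
      by (rule Lim_null_comparison[OF always_eventually[OF allI[OF bound]]])
    then have "(\<lambda>n. jW (iV (extended_sym star \<Theta> (us n)))) \<longlonglongrightarrow> jW (iV (extended_sym star \<Theta> u))"
      by (simp add: LIM_zero_iff)
    then show ?thesis using LIMSEQ_unique[OF w] u(1) by simp
  qed
  then show ?thesis using ps u lim by blast
qed

end
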